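(* Given $0<p\le\infty$, a positive integer $m$ and $\alpha$ real, there is a constant $C=C(p,m,\alpha)>0$ such that $$C^{-1}\|f\|_{F_{\alpha,m}^p}\le\sum_{|\gamma|\le m}\|\partial^\gamma f\|_{L_\alpha^p}\le C\|f\|_{F_{\alpha,m}^p}$$ for all $f\in H(\mathbb{C}^n)$.
   Context: Fix an integer $n\ge1$. $dV$ is Lebesgue volume measure on $\mathbb{C}^n$ normalized so that $\int_{\mathbb{C}^n}e^{-|z|^2}dV(z)=1$; $H(\mathbb{C}^n)$ is the space of entire functions; for a multi-index $\gamma=(\gamma_1,\dots,\gamma_n)$ of nonnegative integers, $|\gamma|=\sum\gamma_j$ and $\partial^\gamma=\partial_1^{\gamma_1}\cdots\partial_n^{\gamma_n}$ with $\partial_j=\partial/\partial z_j$. For $\alpha$ real and $\psi$ measurable on $\mathbb{C}^n$, $\|\psi\|_{L_\alpha^p}=\left\{\int_{\mathbb{C}^n}|\psi(z)e^{-|z|^2/2}|^p(1+|z|)^{-\alpha}dV(z)\right\}^{1/p}$ for $0<p<\infty$, and $\|\psi\|_{L_\alpha^\infty}=\operatorname{esssup}_z\frac{|\psi(z)|e^{-|z|^2/2}}{(1+|z|)^\alpha}$. For $f\in H(\mathbb{C}^n)$ with homogeneous expansion $f=\sum_{k\ge0}f_k$ ($f_k$ a homogeneous polynomial of degree $k$) and $m$ a positive integer, put $\mathcal D^mf=\sum_{k\ge0}\frac{\Gamma(n+m+k)}{\Gamma(n+k)}f_k$, $\mathcal R^mf(z)=(1+|z|)^{-m}\mathcal D^mf(z)$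 and $\|f\|_{F_{\alpha,m}^p}=\|\mathcal R^mf\|_{L_\alpha^p}$. All these quantities are allowed to be $+\infty$. *)

theory Defs
  imports "HOL-Probability.Probability" "HOL-Complex_Analysis.Complex_Analysis"
begin

text \<open>
  Throughout, \<open>complex ^ 'n\<close> is $\mathbb{C}^n$ with \<open>n = CARD('n)\<close>; its library norm is the
  Hermitian norm \<open>|z|\<close>. All norms take values in \<open>[0, \<infinity>]\<close>, i.e.\ in type \<^typ>\<open>ennreal\<close>.
\<close>


section \<open>Volume measure\<close>

definition dV :: "(complex ^ 'n) measure" where
  "dV = scale_measure (ennreal (1 / pi ^ CARD('n))) lebesgue"

lemma nn_integral_gaussian_real:
  "(\<integral>\<^sup>+x. ennreal (exp (- x\<^sup>2)) \<partial>lborel) = ennreal (sqrt pi)"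
proof -
  have "has_bochner_integral lborel (\<lambda>x::real. exp (- x\<^sup>2)) (2 *\<^sub>R (sqrt pi / 2))"
    using gaussian_moment_0 by (rule has_bochner_integral_even_function) simp
  thus ?thesis
    by (simp add: has_bochner_integral_iff nn_integral_eq_integral)
qed

lemma nn_integral_gaussian:
  "(\<integral>\<^sup>+z. ennreal (exp (- (norm (z :: 'a::euclidean_space))\<^sup>2)) \<partial>lborel)
     = ennreal (sqrt pi ^ DIM('a))"
proof -
  have "exp (- (norm z)\<^sup>2) = (\<Prod>b\<in>Basis. exp (- (z \<bullet> b)\<^sup>2))" for z :: 'a
    unfolding power2_norm_eq_inner
    by (subst euclidean_inner) (simp add: exp_sum[symmetric] sum_negf power2_eq_square)
  hence "(\<integral>\<^sup>+z. ennreal (exp (- (norm (z :: 'a))\<^sup>2)) \<partial>lborel)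
       = (\<integral>\<^sup>+z. (\<Prod>b\<in>Basis. ennreal (exp (- ((z :: 'a) \<bullet> b)\<^sup>2))) \<partial>lborel)"
    by (simp add: prod_ennreal)
  also have "\<dots> = (\<Prod>b\<in>(Basis::'a set). \<integral>\<^sup>+x. ennreal (exp (- x\<^sup>2)) \<partial>lborel)"
    by (rule nn_integral_lborel_prod) auto
  finally show ?thesis
    by (simp add: nn_integral_gaussian_real ennreal_power)
qed

lemma dV_normalized: "(\<integral>\<^sup>+z. ennreal (exp (- (norm z)\<^sup>2)) \<partial>(dV :: (complex ^ 'n) measure)) = 1"
proof -
  have "sqrt pi ^ DIM(complex ^ 'n) = pi ^ CARD('n)"
    by (simp add: power_mult mult.commute[of _ 2])
  hence "(\<integral>\<^sup>+z. ennreal (exp (- (norm (z :: complex ^ 'n))\<^sup>2)) \<partial>lborel) = ennreal (pi ^ CARD('n))"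
    by (metis nn_integral_gaussian)
  moreover have "(\<lambda>z :: complex ^ 'n. ennreal (exp (- (norm z)\<^sup>2))) \<in> borel_measurable lebesgue"
    by (intro measurable_completion) measurable
  ultimately show ?thesis
    by (simp add: dV_def nn_integral_scale_measure nn_integral_completion flip: ennreal_mult)
qed


section \<open>Weighted Lebesgue norms\<close>

text \<open>Powers of extended nonnegative reals; only used with exponent \<open>a > 0\<close>.\<close>

definition ennreal_rpow :: "ennreal \<Rightarrow> real \<Rightarrow> ennreal" where
  "ennreal_rpow x a = (if x = \<infinity> then \<infinity> else ennreal (enn2real x powr a))"

text \<open>For finite \<open>p\<close> the weight \<open>(1 + |z|) powr (-\<alpha>)\<close> is not raised to the power \<open>p\<close>.\<close>

definition L_norm :: "ennreal \<Rightarrow> real \<Rightarrow> (complex ^ 'n \<Rightarrow> complex) \<Rightarrow> ennreal" where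
  "L_norm p \<alpha> \<psi> =
    (if p = \<infinity>
     then esssup dV (\<lambda>z. ennreal (norm (\<psi> z) * exp (- (norm z)\<^sup>2 / 2) / (1 + norm z) powr \<alpha>))
     else ennreal_rpow
            (\<integral>\<^sup>+z. ennreal ((norm (\<psi> z) * exp (- (norm z)\<^sup>2 / 2)) powr enn2real p
                     * (1 + norm z) powr (- \<alpha>)) \<partial>dV)
            (1 / enn2real p))"


section \<open>Entire functions and their partial derivatives\<close>

definition entire :: "(complex ^ 'n \<Rightarrow> complex) \<Rightarrow> bool" where
  "entire f \<longleftrightarrow>
    (\<forall>z. \<exists>f'. (f has_derivative f') (at z) \<and> (\<forall>c v. f' (c *s v) = c * f' v))"

definition partial_deriv :: "'n \<Rightarrow> (complex ^ 'n \<Rightarrow> complex) \<Rightarrow> complex ^ 'n \<Rightarrow> complex" where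
  "partial_deriv j f z = deriv (\<lambda>w. f (z + axis j w)) 0"

definition multi_order :: "('n::finite \<Rightarrow> nat) \<Rightarrow> nat" where
  "multi_order \<gamma> = (\<Sum>j\<in>UNIV. \<gamma> j)"

text \<open>
  The index type carries no order, so the order of differentiation is an arbitrary enumeration
  of the coordinates, the same for all \<open>\<gamma>\<close>. For entire functions the choice is immaterial, since
  their partial derivatives commute.
\<close>

definition coords :: "'n::finite list" where
  "coords = (SOME js. distinct js \<and> set js = UNIV)"

lemma coords: "distinct (coords :: 'n::finite list)" "set (coords :: 'n list) = UNIV"
proof -
  have "\<exists>js :: 'n list. distinct js \<and> set js = UNIV"
    using finite_distinct_list[of "UNIV :: 'n set"] by auto
  from someI_ex[OF this] show "distinct (coords :: 'n list)" "set (coords :: 'n list) = UNIV"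
    by (simp_all add: coords_def)
qed

definition multi_deriv ::
    "('n \<Rightarrow> nat) \<Rightarrow> (complex ^ 'n \<Rightarrow> complex) \<Rightarrow> complex ^ 'n \<Rightarrow> complex" where
  "multi_deriv \<gamma> f = foldr (\<lambda>j. partial_deriv j ^^ \<gamma> j) coords f"

lemma finite_multi_order_le: "finite {\<gamma> :: 'n::finite \<Rightarrow> nat. multi_order \<gamma> \<le> m}"
proof (rule finite_subset)
  have "\<gamma> j \<le> multi_order \<gamma>" for \<gamma> :: "'n \<Rightarrow> nat" and j
    unfolding multi_order_def by (rule member_le_sum) auto
  thus "{\<gamma> :: 'n \<Rightarrow> nat. multi_order \<gamma> \<le> m} \<subseteq> (UNIV \<rightarrow>\<^sub>E {..m})"
    by (auto simp: PiE_UNIV_domain intro: order_trans)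
  show "finite (UNIV \<rightarrow>\<^sub>E {..m} :: ('n \<Rightarrow> nat) set)"
    by (intro finite_PiE) auto
qed

lemma finite_multi_order_eq: "finite {\<gamma> :: 'n::finite \<Rightarrow> nat. multi_order \<gamma> = m}"
  by (rule finite_subset[OF _ finite_multi_order_le[of m]]) auto


section \<open>Homogeneous expansion and the Fock--Sobolev norm\<close>

definition homogeneous_poly :: "nat \<Rightarrow> (complex ^ 'n \<Rightarrow> complex) \<Rightarrow> bool" where
  "homogeneous_poly k g \<longleftrightarrow>
    (\<exists>c. \<forall>z. g z = (\<Sum>\<gamma>\<in>{\<gamma>. multi_order \<gamma> = k}. c \<gamma> * (\<Prod>j\<in>UNIV. (z $ j) ^ \<gamma> j)))"

definition homogeneous_expansion ::
    "(complex ^ 'n \<Rightarrow> complex) \<Rightarrow> (nat \<Rightarrow> complex ^ 'n \<Rightarrow> complex) \<Rightarrow> bool" where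
  "homogeneous_expansion f F \<longleftrightarrow>
    (\<forall>k. homogeneous_poly k (F k)) \<and> (\<forall>z. (\<lambda>k. F k z) sums f z)"

definition hom_part :: "(complex ^ 'n \<Rightarrow> complex) \<Rightarrow> nat \<Rightarrow> complex ^ 'n \<Rightarrow> complex" where
  "hom_part f = (THE F. homogeneous_expansion f F)"

lemma homogeneous_poly_scale:
  assumes "homogeneous_poly k g"
  shows "g (w *s z) = w ^ k * g z"
proof -
  from assms obtain c where
    c: "\<And>z. g z = (\<Sum>\<gamma>\<in>{\<gamma>. multi_order \<gamma> = k}. c \<gamma> * (\<Prod>j\<in>UNIV. (z $ j) ^ \<gamma> j))"
    by (auto simp: homogeneous_poly_def)
  show ?thesis
    unfolding c sum_distrib_left
    by (rule sum.cong)
      (auto simp: power_mult_distrib prod.distrib multi_order_def power_sum mult_ac)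
qed

lemma homogeneous_expansion_unique:
  assumes "homogeneous_expansion f F" "homogeneous_expansion f G"
  shows "F = G"
proof (rule ext, rule ext)
  fix k z
  define a where "a k = F k z - G k z" for k
  have "(\<lambda>k. F k (w *s z) - G k (w *s z)) sums (f (w *s z) - f (w *s z))" for w
    using assms by (intro sums_diff) (auto simp: homogeneous_expansion_def)
  moreover have "F k (w *s z) - G k (w *s z) = a k * w ^ k" for k w
    using assms homogeneous_poly_scale[of k "F k" w z] homogeneous_poly_scale[of k "G k" w z]
    by (simp add: homogeneous_expansion_def a_def algebra_simps)
  ultimately have *: "(\<lambda>k. a k * w ^ k) sums 0" for w
    by simp
  have "a k = 0"
  proof (rule ccontr)
    assume "a k \<noteq> 0"
    moreover have "a 0 = 0"
      using *[of 0] powser_sums_zero[of a] sums_unique2 by blast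
    ultimately have "k > 0" "a k \<noteq> 0"
      by (cases k; simp)+
    have "\<exists>s>0. \<forall>w::complex. w \<in> cball 0 s - {0} \<longrightarrow> (0::complex) \<noteq> 0"
      by (rule powser_0_nonzero[of 1 0 a "\<lambda>_. 0" k])
        (use * \<open>k > 0\<close> \<open>a k \<noteq> 0\<close> in \<open>simp_all, blast\<close>)
    then obtain s where "s > 0" "\<forall>w::complex. w \<in> cball 0 s - {0} \<longrightarrow> (0::complex) \<noteq> 0"
      by blast
    from this(2)[rule_format, of "of_real s"] \<open>s > 0\<close> show False
      by simp
  qed
  thus "F k z = G k z"
    by (simp add: a_def)
qed

lemma hom_part_eqI: "homogeneous_expansion f F \<Longrightarrow> hom_part f = F"
  unfolding hom_part_def by (rule the_equality) (auto intro: homogeneous_expansion_unique)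

definition D_op :: "nat \<Rightarrow> (complex ^ 'n \<Rightarrow> complex) \<Rightarrow> complex ^ 'n \<Rightarrow> complex" where
  "D_op m f z =
    (\<Sum>k. of_real (Gamma (real (CARD('n) + m + k)) / Gamma (real (CARD('n) + k))) * hom_part f k z)"

definition R_op :: "nat \<Rightarrow> (complex ^ 'n \<Rightarrow> complex) \<Rightarrow> complex ^ 'n \<Rightarrow> complex" where
  "R_op m f z = D_op m f z / of_real ((1 + norm z) ^ m)"

definition F_norm :: "ennreal \<Rightarrow> real \<Rightarrow> nat \<Rightarrow> (complex ^ 'n \<Rightarrow> complex) \<Rightarrow> ennreal" where
  "F_norm p \<alpha> m f = L_norm p \<alpha> (R_op m f)"

end

theory Submission
  imports Defs "HOL-Real_Asymp.Real_Asymp"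
begin

text \<open>
  Write \<open>E\<^sub>c f = c f + \<Sum>\<^sub>j z\<^sub>j \<partial>\<^sub>j f\<close>. Then \<open>D_op m\<close> is the product of the \<open>E\<^sub>c\<close> with
  \<open>n \<le> c < n + m\<close>, a differential operator of order \<open>m\<close> with polynomial coefficients of degree
  at most \<open>m\<close>; this gives the lower bound pointwise.

  For the upper bound, Cauchy's estimate on balls of radius \<open>1 / (1 + |z|)\<close>, on which the weight
  \<open>exp (- |z|\<^sup>2 / 2)\<close> is essentially constant, lets each derivative cost one factor
  \<open>1 + |z|\<close>. It remains to bound \<open>(1 + |z|)\<^sup>2 f\<close> by \<open>E\<^sub>c f\<close>, which is then iterated \<open>m\<close> times.
  Here \<open>t\<^sup>c f(t z)\<close> has \<open>t\<close>-derivative \<open>t\<^bsup>c - 1\<^esup> (E\<^sub>c f)(t z)\<close>, so \<open>f(z)\<close> differs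
  from \<open>t\<^sup>c f(t z)\<close>, where \<open>1 - t\<close> is about \<open>\<kappa> / (1 + |z|)\<^sup>2\<close>, by at most
  \<open>\<kappa> / (1 + |z|)\<^sup>2\<close> times a nearby value of \<open>E\<^sub>c f\<close>. As the weight is exponentially smaller
  at \<open>z\<close> than at \<open>t z\<close>, the contribution of \<open>f(t z)\<close> can be absorbed for large \<open>\<kappa>\<close>.
  All averaging steps use only the sub-mean-value property of \<open>|f|\<^sup>p\<close>, so \<open>p < 1\<close> is no exception.
\<close>

section \<open>Functions that are entire along complex lines\<close>

text \<open>A step of length \<open>r\<close> changes \<open>|z|^2\<close> by about
  \<open>2 |z| r\<close>, so \<open>1 / (1 + |z|)\<close> is the scale on which the Gaussian weight
  varies by a bounded factor. A radial move by \<open>\<kappa>\<close> such units is a change of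
  \<open>t\<close> by about \<open>\<kappa> / (1 + |z|)^2\<close>; this is where the two powers of
  \<open>1 + |z|\<close> gained from one Euler operator come from. Two obstacles shape the proof.
  Absorption subtracts half of a quantity from itself, which requires the quantity to be finite,
  while the norms may be infinite. It is therefore carried out for truncations of \<open>f\<close>
  to balls about the origin: an inward move does not leave such a ball, so the same truncation
  occurs on both sides, and the resulting bound does not depend on the radius. Secondly,
  \<open>\<kappa>\<close> can only be chosen once the averaging constants are known, so the
  averaging estimate is stated with constants independent of the distance \<open>K\<close> and the
  gain \<theta>, and with its dependence on both explicit.\<close>

lemma norm_vector_scalar_mult: "norm (c *s z) = norm c * norm z"
  for c :: complex and z :: "complex ^ 'n"
  by (simp add: norm_vec_def L2_set_def norm_mult power_mult_distrib
      sum_distrib_left[symmetric] real_sqrt_mult)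

lemma of_real_vector_scalar_mult: "complex_of_real t *s z = t *\<^sub>R z"
  by (auto simp: vec_eq_iff) (auto simp: scaleR_conv_of_real)

text \<open>
  Continuity together with complex differentiability along lines, with derivatives linear in the
  direction, is all that is used of entire functions. It passes to partial derivatives, which
  are locally uniform limits of difference quotients, so no Cauchy formula in several
  variables is needed.
\<close>

definition slice_entire :: "(complex ^ 'n \<Rightarrow> complex) \<Rightarrow> bool" where
  "slice_entire f \<longleftrightarrow> continuous_on UNIV f \<and>
    (\<forall>z v. ((\<lambda>w. f (z + w *s v)) has_field_derivative
             (\<Sum>j\<in>UNIV. v $ j * partial_deriv j f z)) (at 0))"

lemma axis_scalar: "axis j w = w *s axis j (1::complex)"
  by (simp add: vec_eq_iff axis_def)

lemma partial_deriv_slice: "partial_deriv j f z = deriv (\<lambda>w. f (z + w *s axis j 1)) 0"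
  unfolding partial_deriv_def by (subst axis_scalar) simp

lemma sum_axis_1: "(\<Sum>i\<in>UNIV. axis j (1::complex) $ i * D i) = D j"
  by (simp add: axis_def if_distrib[of "\<lambda>x. x * _"] cong: if_cong)

text \<open>Testing the direction \<open>axis j 1\<close> forces the coefficients to be the partial
  derivatives. A candidate \<open>D\<close> may thus be guessed, and checking it along lines gives
  membership in the class together with a formula for the derivatives.\<close>

lemma slice_entireI:
  assumes cont: "continuous_on UNIV f"
    and der: "\<And>z v. ((\<lambda>w. f (z + w *s v)) has_field_derivative (\<Sum>j\<in>UNIV. v $ j * D j z)) (at 0)"
  shows "slice_entire f" "partial_deriv j f = D j"
proof -
  have *: "partial_deriv j f z = D j z" for j z
    using DERIV_imp_deriv[OF der[of z "axis j 1"]]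
    by (simp add: partial_deriv_slice sum_axis_1)
  show "slice_entire f"
    unfolding slice_entire_def using assms by (simp add: *)
  show "partial_deriv j f = D j" using * by auto
qed

lemma slice_entire_continuous: "slice_entire f \<Longrightarrow> continuous_on UNIV f"
  by (simp add: slice_entire_def)

lemma slice_entire_deriv:
  assumes "slice_entire f"
  shows "((\<lambda>w. f (z + w *s v)) has_field_derivative
           (\<Sum>j\<in>UNIV. v $ j * partial_deriv j f (z + w *s v))) (at w)"
proof -
  have "((\<lambda>u. f (z + w *s v + u *s v)) has_field_derivative
           (\<Sum>j\<in>UNIV. v $ j * partial_deriv j f (z + w *s v))) (at 0)"
    using assms by (simp add: slice_entire_def)
  hence "((\<lambda>u. f (z + (u + w) *s v)) has_field_derivative
           (\<Sum>j\<in>UNIV. v $ j * partial_deriv j f (z + w *s v))) (at 0)"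
    by (simp add: vector_sadd_rdistrib add_ac)
  thus ?thesis
    using DERIV_shift[of "\<lambda>u. f (z + u *s v)" _ 0 w] by simp
qed

lemma slice_entire_holomorphic:
  "slice_entire f \<Longrightarrow> (\<lambda>w. f (z + w *s v)) holomorphic_on S"
  using slice_entire_deriv[of f z v] field_differentiable_at_within
  unfolding holomorphic_on_def field_differentiable_def by blast

lemma slice_entire_deriv0:
  assumes "slice_entire f"
  shows "((\<lambda>w. f (w *s v)) has_field_derivative
           (\<Sum>j\<in>UNIV. v $ j * partial_deriv j f (w *s v))) (at w)"
  using slice_entire_deriv[OF assms, of 0 v w] by simp

lemma slice_entire_holomorphic0: "slice_entire f \<Longrightarrow> (\<lambda>w. f (w *s v)) holomorphic_on S"
  using slice_entire_holomorphic[of f 0 v S] by simp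

text \<open>Complex homogeneity of the real-linear derivative \<open>f'\<close> makes
  \<open>f' (w *s v)\<close> a multiple of \<open>w\<close>, that is, a complex derivative on every
  line.\<close>

lemma slice_entire_if_entire:
  assumes "entire f"
  shows "slice_entire f"
proof (rule slice_entireI(1))
  show "continuous_on UNIV f"
    using assms has_derivative_continuous unfolding entire_def continuous_on_eq_continuous_at[OF open_UNIV]
    by blast
  fix z v
  from assms obtain f' where f': "(f has_derivative f') (at z)" "\<And>c v. f' (c *s v) = c * f' v"
    unfolding entire_def by blast
  interpret linear f' using f'(1) has_derivative_linear by blast
  have lin: "bounded_linear (\<lambda>w. w *s v)" for v :: "complex ^ 'n"
    by (rule bounded_linear_intro[where K="norm v"])
      (auto simp: vec_eq_iff algebra_simps norm_vector_scalar_mult)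
  have "((\<lambda>w. f (z + w *s v)) has_derivative (\<lambda>w. f' (w *s v))) (at 0)" for v
  proof -
    have "((\<lambda>w. z + w *s v) has_derivative (\<lambda>w. w *s v)) (at 0)"
      using bounded_linear_imp_has_derivative[OF lin] by (auto intro!: derivative_eq_intros)
    moreover have "(f has_derivative f') (at (z + 0 *s v))"
      using f'(1) by simp
    ultimately show ?thesis
      by (rule has_derivative_compose)
  qed
  hence d: "((\<lambda>w. f (z + w *s v)) has_field_derivative f' v) (at 0)" for v
    by (simp add: has_field_derivative_def f'(2) mult_commute_abs)
  have "f' v = (\<Sum>j\<in>UNIV. f' (v $ j *s axis j 1))"
    by (subst basis_expansion[of v, symmetric]) (rule sum)
  also have "\<dots> = (\<Sum>j\<in>UNIV. v $ j * partial_deriv j f z)"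
    using DERIV_imp_deriv[OF d] by (simp add: f'(2) partial_deriv_slice)
  finally show "((\<lambda>w. f (z + w *s v)) has_field_derivative (\<Sum>j\<in>UNIV. v $ j * partial_deriv j f z)) (at 0)"
    using d[of v] by simp
qed

lemma slice_entire_bounded:
  assumes "slice_entire f"
  obtains M where "M > 0" "\<And>z. norm z \<le> R \<Longrightarrow> norm (f z) \<le> M"
proof -
  have "compact (f ` cball 0 R)"
    using slice_entire_continuous[OF assms]
    by (intro compact_continuous_image compact_cball) (auto intro: continuous_on_subset)
  then obtain M where "M > 0" "\<forall>x\<in>f ` cball 0 R. norm x \<le> M"
    by (meson bounded_pos compact_imp_bounded)
  thus ?thesis by (intro that[of M]) auto
qed

section \<open>Partial derivatives as limits of difference quotients\<close>

definition diff_quot :: "'n \<Rightarrow> (complex ^ 'n \<Rightarrow> complex) \<Rightarrow> nat \<Rightarrow> complex ^ 'n \<Rightarrow> complex" where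
  "diff_quot j f k z = (f (z + of_real (inverse (real (Suc k))) *s axis j 1) - f z)
     * of_nat (Suc k)"

text \<open>Second-order Taylor expansion in the direction \<open>axis j 1\<close>: Cauchy's
  inequality bounds the second derivative uniformly for \<open>z\<close> in the ball, which leaves
  an error of order \<open>1 / (k + 1)\<close>.\<close>

lemma diff_quot_uniform_limit:
  assumes "slice_entire f"
  shows "uniform_limit (cball 0 R) (diff_quot j f) (partial_deriv j f) sequentially"
proof -
  \<comment> \<open>One unit of room is for the increment \<open>h\<close>, the other for the Cauchy
    circles of radius 1 about points of the unit disc.\<close>
  obtain M where M: "M > 0" "\<And>z. norm z \<le> R + 2 \<Longrightarrow> norm (f z) \<le> M"
    using slice_entire_bounded[OF assms] by metis
  have est: "norm (diff_quot j f k z - partial_deriv j f z) \<le> 2 * M * inverse (real (Suc k))"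
    if z: "norm z \<le> R" for z k
  proof -
    define \<phi> where "\<phi> = (\<lambda>w. f (z + w *s axis j 1))"
    have hol: "\<phi> holomorphic_on S" for S
      unfolding \<phi>_def by (rule slice_entire_holomorphic[OF assms])
    have b: "norm (\<phi> w) \<le> M" if "norm w \<le> 2" for w
      unfolding \<phi>_def using z that norm_triangle_ineq[of z "w *s axis j 1"]
      by (intro M) (simp add: norm_vector_scalar_mult norm_axis_1)
    have d2: "norm ((deriv ^^ 2) \<phi> w) \<le> 2 * M" if "norm w \<le> 1" for w
    proof -
      have "norm ((deriv ^^ 2) \<phi> w) \<le> fact 2 * M / 1 ^ 2"
      proof (rule Cauchy_inequality)
        fix x assume "norm (w - x) = 1"
        thus "norm (\<phi> x) \<le> M" using that norm_triangle_ineq4[of w "w - x"] by (intro b) auto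
      qed (auto intro: hol holomorphic_on_imp_continuous_on)
      thus ?thesis by simp
    qed
    define h where "h = complex_of_real (inverse (real (Suc k)))"
    have h: "norm h \<le> 1" "h \<noteq> 0" "norm h = inverse (real (Suc k))" "of_nat (Suc k) = inverse h"
      by (auto simp: h_def norm_inverse norm_divide field_simps simp del: of_nat_Suc)
    have "norm ((deriv ^^ 0) \<phi> h - (\<Sum>i\<le>1. (deriv ^^ i) \<phi> 0 * (h - 0) ^ i / fact i))
        \<le> (2 * M) * norm (h - 0) ^ Suc 1 / fact 1"
    proof (rule complex_Taylor[where S="cball 0 1" and f="\<lambda>i. (deriv ^^ i) \<phi>"])
      fix i :: nat and x
      show "((deriv ^^ i) \<phi> has_field_derivative (deriv ^^ Suc i) \<phi> x) (at x within cball 0 1)"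
        using holomorphic_derivI[of "(deriv ^^ i) \<phi>" UNIV x] holomorphic_higher_deriv[OF hol, of UNIV]
        by (auto intro: has_field_derivative_at_within)
    next
      fix x :: complex assume "x \<in> cball 0 1"
      thus "norm ((deriv ^^ Suc 1) \<phi> x) \<le> 2 * M" using d2[of x] by (simp add: eval_nat_numeral)
    qed (use h in \<open>auto\<close>)
    hence "norm (\<phi> h - \<phi> 0 - deriv \<phi> 0 * h) \<le> 2 * M * norm h ^ 2"
      by (simp add: power2_eq_square algebra_simps)
    hence "norm (\<phi> h - \<phi> 0 - deriv \<phi> 0 * h) / norm h \<le> 2 * M * norm h"
      using h(2) by (simp add: divide_le_eq power2_eq_square mult.assoc)
    moreover have "norm (\<phi> h - \<phi> 0 - deriv \<phi> 0 * h) / norm h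
        = norm (diff_quot j f k z - partial_deriv j f z)"
    proof -
      have "diff_quot j f k z = (\<phi> h - \<phi> 0) * inverse h"
        unfolding h(4)[symmetric] by (simp add: diff_quot_def \<phi>_def h_def)
      hence "diff_quot j f k z - partial_deriv j f z = (\<phi> h - \<phi> 0 - deriv \<phi> 0 * h) / h"
        using h(2) by (simp add: partial_deriv_slice \<phi>_def[symmetric] field_simps)
      thus ?thesis by (simp add: norm_divide)
    qed
    ultimately show ?thesis using h by simp
  qed
  have "(\<lambda>k. 2 * M * inverse (real (Suc k))) \<longlonglongrightarrow> 2 * M * 0"
    by (intro tendsto_intros LIMSEQ_inverse_real_of_nat)
  hence lim: "(\<lambda>k. 2 * M * inverse (real (Suc k))) \<longlonglongrightarrow> 0" by simp
  show ?thesis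
  proof (rule uniform_limitI)
    fix e :: real assume "e > 0"
    with lim have "\<forall>\<^sub>F k in sequentially. 2 * M * inverse (real (Suc k)) < e"
      by (rule order_tendstoD(2))
    thus "\<forall>\<^sub>F k in sequentially. \<forall>x\<in>cball 0 R. dist (diff_quot j f k x) (partial_deriv j f x) < e"
      unfolding dist_norm mem_cball_0 Ball_def
      by eventually_elim (blast intro: order_le_less_trans est)
  qed
qed

lemma diff_quot_slice_deriv:
  assumes "slice_entire f"
  shows "((\<lambda>w. diff_quot j f k (z + w *s v)) has_field_derivative
      (\<Sum>i\<in>UNIV. v $ i * diff_quot j (partial_deriv i f) k (z + w *s v))) (at w)"
proof -
  let ?e = "of_real (inverse (real (Suc k))) *s axis j (1::complex) :: complex ^ 'a"
  have "((\<lambda>w. f (z + ?e + w *s v)) has_field_derivative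
      (\<Sum>i\<in>UNIV. v $ i * partial_deriv i f (z + ?e + w *s v))) (at w)"
    by (rule slice_entire_deriv[OF assms])
  moreover have "z + ?e + w *s v = z + w *s v + ?e" for w
    by (simp only: add_ac)
  ultimately have 1: "((\<lambda>w. f (z + w *s v + ?e)) has_field_derivative
      (\<Sum>i\<in>UNIV. v $ i * partial_deriv i f (z + w *s v + ?e))) (at w)"
    by (simp only:)
  show ?thesis
    unfolding diff_quot_def
    by (rule DERIV_cong[OF DERIV_cmult_right[OF DERIV_diff[OF 1 slice_entire_deriv[OF assms]]]])
       (simp add: sum_subtractf[symmetric] sum_distrib_right sum_distrib_left algebra_simps)
qed

text \<open>Weierstrass' theorem on each line: the difference quotients are holomorphic there and
  converge uniformly on discs, so the limit is holomorphic and its derivative is the limit of their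
  derivatives. Since differencing commutes with differentiation along lines, those derivatives are
  again difference quotients, now of the partial derivatives of \<open>f\<close>; this is the second
  conclusion, from which symmetry of the mixed derivatives follows.\<close>

lemma slice_entire_partial_deriv_aux:
  assumes "slice_entire f"
  shows "slice_entire (partial_deriv j f)"
    and "(\<lambda>k. diff_quot j (partial_deriv i f) k z) \<longlonglongrightarrow> partial_deriv i (partial_deriv j f) z"
proof -
  have cdq: "continuous_on S (diff_quot j f k)" for k S
    unfolding diff_quot_def
    by (intro continuous_intros continuous_on_compose2[OF slice_entire_continuous[OF assms]]) auto
  have "continuous_on (cball 0 R) (partial_deriv j f)" for R
    by (rule uniform_limit_theorem[OF _ diff_quot_uniform_limit[OF assms]]) (simp_all add: cdq)
  hence "continuous_on (ball 0 R) (partial_deriv j f)" for R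
    by (rule continuous_on_subset) (rule ball_subset_cball)
  hence cont: "continuous_on UNIV (partial_deriv j f)"
    unfolding continuous_on_eq_continuous_at[OF open_UNIV]
    by (metis centre_in_ball continuous_on_eq_continuous_at dist_0_norm gt_ex mem_ball open_ball)
  have ul: "uniform_limit (cball 0 R) (\<lambda>k w. diff_quot j f k (z + w *s v))
      (\<lambda>w. partial_deriv j f (z + w *s v)) sequentially" for R z v
  proof -
    have "z + w *s v \<in> cball 0 (norm z + R * norm v)" if "w \<in> cball 0 R" for w
      using that norm_triangle_ineq[of z "w *s v"] mult_right_mono[of "norm w" R "norm v"]
      by (simp add: norm_vector_scalar_mult)
    thus ?thesis
      by (intro uniform_limit_compose'[OF diff_quot_uniform_limit[OF assms, of j "norm z + R * norm v"]]) simp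
  qed
  have hol: "(\<lambda>w. partial_deriv j f (z + w *s v)) holomorphic_on ball 0 1" for z v
  proof (rule holomorphic_uniform_limit[where F=sequentially and z=0 and r=1 and g="\<lambda>w. partial_deriv j f (z + w *s v)"
        and f="\<lambda>k w. diff_quot j f k (z + w *s v)"])
    have "(\<lambda>w. diff_quot j f k (z + w *s v)) holomorphic_on S" for k S
      using diff_quot_slice_deriv[OF assms, of j k z v] field_differentiable_at_within
      unfolding holomorphic_on_def field_differentiable_def by blast
    thus "\<forall>\<^sub>F k in sequentially. continuous_on (cball 0 1) (\<lambda>w. diff_quot j f k (z + w *s v)) \<and>
       (\<lambda>w. diff_quot j f k (z + w *s v)) holomorphic_on ball 0 1"
      by (auto intro!: always_eventually holomorphic_on_imp_continuous_on)
  qed (use ul[where R=1] in simp_all)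
  define D where "D z v = deriv (\<lambda>w. partial_deriv j f (z + w *s v)) 0" for z v
  have D: "((\<lambda>w. partial_deriv j f (z + w *s v)) has_field_derivative D z v) (at 0)" for z v
    unfolding D_def by (rule holomorphic_derivI[OF hol]) auto
  have lim: "(\<lambda>k. \<Sum>i\<in>UNIV. v $ i * diff_quot j (partial_deriv i f) k z) \<longlonglongrightarrow> D z v" for z v
  proof -
    have "(\<lambda>k. (deriv ^^ 1) (\<lambda>w. diff_quot j f k (z + w *s v)) 0) \<longlonglongrightarrow>
        (deriv ^^ 1) (\<lambda>w. partial_deriv j f (z + w *s v)) 0"
    proof (rule higher_deriv_complex_uniform_limit[where A="ball 0 1"])
      show "uniform_limit (ball 0 1) (\<lambda>k w. diff_quot j f k (z + w *s v))
          (\<lambda>w. partial_deriv j f (z + w *s v)) sequentially"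
        by (rule uniform_limit_on_subset[OF ul ball_subset_cball])
      have "(\<lambda>w. diff_quot j f k (z + w *s v)) holomorphic_on S" for k S
        using diff_quot_slice_deriv[OF assms, of j k z v] field_differentiable_at_within
        unfolding holomorphic_on_def field_differentiable_def by blast
      thus "\<forall>\<^sub>F k in sequentially. (\<lambda>w. diff_quot j f k (z + w *s v)) holomorphic_on ball 0 1"
        by simp
    qed auto
    thus ?thesis
      using DERIV_imp_deriv[OF diff_quot_slice_deriv[OF assms, of j _ z v 0]] by (simp add: D_def)
  qed
  have lim1: "(\<lambda>k. diff_quot j (partial_deriv i f) k z) \<longlonglongrightarrow> D z (axis i 1)" for i z
    using lim[of "axis i 1" z] by (simp add: sum_axis_1)
  \<comment> \<open>Linearity in the direction survives the limit: it holds for each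
    \<open>k\<close>, and each coefficient converges by \<open>lim1\<close>.\<close>
  have Dsum: "D z v = (\<Sum>i\<in>UNIV. v $ i * D z (axis i 1))" for z v
    by (rule LIMSEQ_unique[OF lim]) (intro tendsto_intros lim1)
  show "slice_entire (partial_deriv j f)"
  proof (rule slice_entireI(1)[OF cont])
    show "((\<lambda>w. partial_deriv j f (z + w *s v)) has_field_derivative
        (\<Sum>i\<in>UNIV. v $ i * D z (axis i 1))) (at 0)" for z v
      using D[of z v] by (subst Dsum[symmetric])
  qed
  show "(\<lambda>k. diff_quot j (partial_deriv i f) k z) \<longlonglongrightarrow> partial_deriv i (partial_deriv j f) z"
    using lim1 by (simp add: D_def partial_deriv_slice[of i "partial_deriv j f"])
qed

lemmas slice_entire_partial_deriv = slice_entire_partial_deriv_aux(1)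

text \<open>The quotients in direction \<open>j\<close> of the \<open>i\<close>-th derivative have
  two limits: one because they are difference quotients, the other by interchanging limit and
  derivative.\<close>

lemma partial_deriv_commute:
  assumes "slice_entire f"
  shows "partial_deriv i (partial_deriv j f) = partial_deriv j (partial_deriv i f)"
proof
  fix z
  have "(\<lambda>k. diff_quot j (partial_deriv i f) k z) \<longlonglongrightarrow> partial_deriv j (partial_deriv i f) z"
    by (rule tendsto_uniform_limitI[OF diff_quot_uniform_limit[where R="norm z"]])
      (auto intro: slice_entire_partial_deriv assms)
  thus "partial_deriv i (partial_deriv j f) z = partial_deriv j (partial_deriv i f) z"
    by (intro LIMSEQ_unique[OF slice_entire_partial_deriv_aux(2)[OF assms]])
qed

section \<open>Euler operators and their commutation with derivatives\<close>

definition euler :: "nat \<Rightarrow> (complex ^ 'n \<Rightarrow> complex) \<Rightarrow> complex ^ 'n \<Rightarrow> complex" where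
  "euler c f z = of_nat c * f z + (\<Sum>j\<in>UNIV. z $ j * partial_deriv j f z)"

text \<open>Differentiating the factor \<open>z $ j\<close> contributes one more copy of the
  \<open>j\<close>-th derivative, which raises the parameter by one; symmetry of the mixed
  derivatives puts the rest back into Euler form.\<close>

lemma slice_entire_euler_aux:
  assumes "slice_entire f"
  shows "slice_entire (euler c f)"
    and "partial_deriv j (euler c f) = euler (Suc c) (partial_deriv j f)"
proof -
  note sp = slice_entire_partial_deriv[OF assms]
  have c: "continuous_on UNIV (euler c f)"
    unfolding euler_def
    by (intro continuous_intros slice_entire_continuous assms sp)
  have d: "((\<lambda>w. euler c f (z + w *s v)) has_field_derivative
      (\<Sum>j\<in>UNIV. v $ j * euler (Suc c) (partial_deriv j f) z)) (at 0)" for z v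
  proof -
    have 1: "((\<lambda>w. (z + w *s v) $ j * partial_deriv j f (z + w *s v)) has_field_derivative
       (v $ j * partial_deriv j f z + z $ j * (\<Sum>i\<in>UNIV. v $ i * partial_deriv i (partial_deriv j f) z))) (at 0)" for j
    proof -
      have "((\<lambda>w. (z + w *s v) $ j) has_field_derivative v $ j) (at 0)"
        by (auto intro!: derivative_eq_intros)
      from DERIV_mult[OF this slice_entire_deriv[OF sp[of j], of z v 0]] show ?thesis
        by (simp add: algebra_simps)
    qed
    have "((\<lambda>w. of_nat c * f (z + w *s v)) has_field_derivative
       (of_nat c * (\<Sum>j\<in>UNIV. v $ j * partial_deriv j f z))) (at 0)"
      using DERIV_cmult[OF slice_entire_deriv[OF assms, of z v 0]] by simp
    from DERIV_add[OF this DERIV_sum[of UNIV, OF 1]]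
    show ?thesis
      unfolding euler_def
    proof (rule DERIV_cong)
      have "(\<Sum>j\<in>UNIV. z $ j * (\<Sum>i\<in>UNIV. v $ i * partial_deriv i (partial_deriv j f) z))
          = (\<Sum>i\<in>UNIV. \<Sum>j\<in>UNIV. z $ j * (v $ i * partial_deriv i (partial_deriv j f) z))"
        unfolding sum_distrib_left by (rule sum.swap)
      also have "\<dots> = (\<Sum>i\<in>UNIV. v $ i * (\<Sum>j\<in>UNIV. z $ j * partial_deriv j (partial_deriv i f) z))"
        unfolding sum_distrib_left
        by (intro sum.cong refl) (subst partial_deriv_commute[OF assms], simp only: mult.left_commute)
      finally have swap: "(\<Sum>j\<in>UNIV. z $ j * (\<Sum>i\<in>UNIV. v $ i * partial_deriv i (partial_deriv j f) z)) = \<dots>" .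
      have "(\<Sum>j\<in>UNIV. v $ j * (of_nat (Suc c) * partial_deriv j f z +
            (\<Sum>i\<in>UNIV. z $ i * partial_deriv i (partial_deriv j f) z)))
          = (\<Sum>j\<in>UNIV. of_nat c * (v $ j * partial_deriv j f z) + (v $ j * partial_deriv j f z +
              v $ j * (\<Sum>i\<in>UNIV. z $ i * partial_deriv i (partial_deriv j f) z)))"
        by (intro sum.cong refl) (simp add: distrib_left distrib_right)
      thus "of_nat c * (\<Sum>j\<in>UNIV. v $ j * partial_deriv j f z) +
        (\<Sum>j\<in>UNIV. v $ j * partial_deriv j f z +
          z $ j * (\<Sum>i\<in>UNIV. v $ i * partial_deriv i (partial_deriv j f) z)) =
        (\<Sum>j\<in>UNIV. v $ j * (of_nat (Suc c) * partial_deriv j f z +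
          (\<Sum>i\<in>UNIV. z $ i * partial_deriv i (partial_deriv j f) z)))"
        unfolding sum.distrib swap sum_distrib_left[of "of_nat c"] by simp
    qed
  qed
  show "slice_entire (euler c f)" "partial_deriv j (euler c f) = euler (Suc c) (partial_deriv j f)"
    using slice_entireI[OF c d] by auto
qed

lemmas slice_entire_euler = slice_entire_euler_aux(1)
lemmas partial_deriv_euler = slice_entire_euler_aux(2)

section \<open>Mixed derivatives and the Euler operator\<close>

lemma slice_entire_funpow_partial_deriv:
  "slice_entire f \<Longrightarrow> slice_entire ((partial_deriv j ^^ k) f)"
  by (induction k) (auto intro: slice_entire_partial_deriv)

lemma slice_entire_foldr_partial_deriv:
  "slice_entire f \<Longrightarrow> slice_entire (foldr (\<lambda>j. partial_deriv j ^^ \<gamma> j) js f)"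
  by (induction js) (auto intro: slice_entire_funpow_partial_deriv)

lemma slice_entire_multi_deriv: "slice_entire f \<Longrightarrow> slice_entire (multi_deriv \<gamma> f)"
  unfolding multi_deriv_def by (rule slice_entire_foldr_partial_deriv)

lemma partial_deriv_funpow_commute:
  "slice_entire f \<Longrightarrow> partial_deriv i ((partial_deriv j ^^ k) f) = (partial_deriv j ^^ k) (partial_deriv i f)"
  by (induction k)
    (auto simp: partial_deriv_commute[OF slice_entire_funpow_partial_deriv, of f i])

text \<open>The new derivative commutes past the blocks of other coordinates until it meets its own;
  distinctness of the list ensures that only this block changes.\<close>

lemma partial_deriv_foldr:
  assumes "slice_entire f" "distinct js" "j \<in> set js"
  shows "partial_deriv j (foldr (\<lambda>i. partial_deriv i ^^ \<gamma> i) js f)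
    = foldr (\<lambda>i. partial_deriv i ^^ (\<gamma>(j := Suc (\<gamma> j))) i) js f"
  using assms(2,3)
proof (induction js)
  case (Cons a js)
  show ?case
  proof (cases "a = j")
    case True
    with Cons.prems have "foldr (\<lambda>i. partial_deriv i ^^ \<gamma> i) js f
        = foldr (\<lambda>i. partial_deriv i ^^ (\<gamma>(j := Suc (\<gamma> j))) i) js f"
      by (intro foldr_cong) auto
    with True show ?thesis by simp
  next
    case False
    with Cons show ?thesis
      by (simp add: partial_deriv_funpow_commute slice_entire_foldr_partial_deriv assms(1))
  qed
qed simp

lemma partial_deriv_multi_deriv:
  "slice_entire f \<Longrightarrow> partial_deriv j (multi_deriv \<gamma> f) = multi_deriv (\<gamma>(j := Suc (\<gamma> j))) f"
  unfolding multi_deriv_def by (rule partial_deriv_foldr) (auto simp: coords)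

lemma multi_order_Suc: "multi_order (\<gamma>(j := Suc (\<gamma> j))) = Suc (multi_order \<gamma>)"
  unfolding multi_order_def by (simp add: sum.remove[of UNIV j])

lemma multi_order_0_iff: "multi_order \<gamma> = 0 \<longleftrightarrow> \<gamma> = (\<lambda>_. 0)"
  by (auto simp: multi_order_def)

lemma multi_order_Suc_cases:
  assumes "multi_order \<gamma> = Suc k"
  obtains j \<gamma>' where "\<gamma> = \<gamma>'(j := Suc (\<gamma>' j))" "multi_order \<gamma>' = k"
proof -
  obtain j where j: "\<gamma> j \<noteq> 0"
    using assms unfolding multi_order_def by (metis nat.distinct(1) sum.neutral)
  let ?\<gamma>' = "\<gamma>(j := \<gamma> j - 1)"
  have *: "\<gamma> = ?\<gamma>'(j := Suc (?\<gamma>' j))" using j by auto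
  with assms multi_order_Suc[of ?\<gamma>' j] have "multi_order ?\<gamma>' = k" by simp
  with * show ?thesis by (rule that)
qed

lemma multi_deriv_0: "multi_deriv (\<lambda>_. 0) f = f"
proof -
  have "foldr (\<lambda>j. partial_deriv j ^^ 0) js f = f" for js by (induction js) auto
  thus ?thesis by (simp add: multi_deriv_def)
qed

lemma funpow_partial_deriv_euler:
  "slice_entire f \<Longrightarrow> (partial_deriv j ^^ k) (euler c f) = euler (c + k) ((partial_deriv j ^^ k) f)"
  by (induction k) (auto simp: partial_deriv_euler slice_entire_funpow_partial_deriv)

lemma multi_deriv_euler:
  assumes "slice_entire f"
  shows "multi_deriv \<gamma> (euler c f) = euler (c + multi_order \<gamma>) (multi_deriv \<gamma> f)"
proof -
  have fold: "foldr (\<lambda>j. partial_deriv j ^^ \<gamma> j) js (euler c f)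
      = euler (c + sum_list (map \<gamma> js)) (foldr (\<lambda>j. partial_deriv j ^^ \<gamma> j) js f)" for js
    by (induction js)
      (auto simp: funpow_partial_deriv_euler slice_entire_foldr_partial_deriv assms add_ac)
  have "sum_list (map \<gamma> coords) = multi_order \<gamma>"
    unfolding multi_order_def sum_list_distinct_conv_sum_set[OF coords(1)] coords(2) ..
  with fold[of coords] show ?thesis unfolding multi_deriv_def by simp
qed

text \<open>
  \<open>euler_prod m\<close> will turn out to be \<open>D_op m\<close>, since \<open>\<Gamma>(n + m + k) / \<Gamma>(n + k)\<close> is the
  product of the \<open>n + i + k\<close> for \<open>i < m\<close>.
\<close>

primrec euler_prod :: "nat \<Rightarrow> (complex ^ 'n \<Rightarrow> complex) \<Rightarrow> complex ^ 'n \<Rightarrow> complex" where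
  "euler_prod 0 f = f"
| "euler_prod (Suc m) f = euler (CARD('n) + m) (euler_prod m f)"

lemma slice_entire_euler_prod: "slice_entire f \<Longrightarrow> slice_entire (euler_prod m f)"
  by (induction m) (auto intro: slice_entire_euler)

text \<open>Only \<gamma> = 0 is needed for \<open>D_op\<close>, but the outermost Euler operator
  applies a further derivative to the inner product, so the induction must run over all \<gamma>.
  Each operator costs one factor \<open>1 + norm z\<close> and one order of differentiation.\<close>

lemma multi_deriv_euler_prod_bound:
  "\<exists>C\<ge>0. \<forall>f :: complex ^ 'n \<Rightarrow> complex. \<forall>z. slice_entire f \<longrightarrow>
     norm (multi_deriv \<gamma> (euler_prod m f) z) \<le> C * (1 + norm z) ^ m *
       (\<Sum>\<gamma>'\<in>{\<gamma>'. multi_order \<gamma>' \<le> multi_order \<gamma> + m}. norm (multi_deriv \<gamma>' f z))"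
proof (induction m arbitrary: \<gamma>)
  case 0
  have "norm (multi_deriv \<gamma> f z) \<le>
      (\<Sum>\<gamma>'\<in>{\<gamma>'. multi_order \<gamma>' \<le> multi_order \<gamma>}. norm (multi_deriv \<gamma>' f z))"
    for f :: "complex ^ 'n \<Rightarrow> complex" and z
    by (rule member_le_sum) (auto intro: finite_multi_order_le)
  thus ?case by (intro exI[of _ 1]) simp
next
  case (Suc m)
  let ?\<gamma> = "\<lambda>j. \<gamma>(j := Suc (\<gamma> j))"
  define N where "N = real (CARD('n) + m + multi_order \<gamma>)"
  define S where "S l f z = (\<Sum>\<gamma>'\<in>{\<gamma>'. multi_order \<gamma>' \<le> l}. norm (multi_deriv \<gamma>' f z))"
    for l and f :: "complex ^ 'n \<Rightarrow> complex" and z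
  have S_mono: "S l f z \<le> S l' f z" if "l \<le> l'" for l l' f z
    unfolding S_def using that by (intro sum_mono2) (auto intro: finite_multi_order_le)
  have S_nonneg: "S l f z \<ge> 0" for l f z
    unfolding S_def by (intro sum_nonneg) auto
  obtain C0 where C0: "C0 \<ge> 0" "\<And>f z. slice_entire f \<Longrightarrow>
      norm (multi_deriv \<gamma> (euler_prod m f) z) \<le> C0 * (1 + norm z) ^ m * S (multi_order \<gamma> + m) f z"
    using Suc.IH[of \<gamma>] unfolding S_def by blast
  obtain C where C: "\<And>j. C j \<ge> 0" "\<And>j f z. slice_entire f \<Longrightarrow>
      norm (multi_deriv (?\<gamma> j) (euler_prod m f) z)
        \<le> C j * (1 + norm z) ^ m * S (multi_order \<gamma> + Suc m) f z"
  proof -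
    have "\<forall>j. \<exists>C\<ge>0. \<forall>f z. slice_entire f \<longrightarrow>
      norm (multi_deriv (?\<gamma> j) (euler_prod m f) z)
        \<le> C * (1 + norm z) ^ m * S (multi_order \<gamma> + Suc m) f z"
    proof
      fix j
      show "\<exists>C\<ge>0. \<forall>f z. slice_entire f \<longrightarrow>
        norm (multi_deriv (?\<gamma> j) (euler_prod m f) z)
          \<le> C * (1 + norm z) ^ m * S (multi_order \<gamma> + Suc m) f z"
        using Suc.IH[of "?\<gamma> j"] by (simp only: S_def multi_order_Suc add_Suc add_Suc_right)
    qed
    thus ?thesis using that by metis
  qed
  have N: "N \<ge> 0" by (simp add: N_def)
  have "norm (multi_deriv \<gamma> (euler_prod (Suc m) f) z)
      \<le> (N * C0 + sum C UNIV) * (1 + norm z) ^ Suc m * S (multi_order \<gamma> + Suc m) f z"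
    if f: "slice_entire f" for f z
  proof -
    let ?g = "euler_prod m f"
    note g = slice_entire_euler_prod[OF f, of m]
    let ?X = "(1 + norm z) ^ Suc m * S (multi_order \<gamma> + Suc m) f z"
    have "multi_deriv \<gamma> (euler_prod (Suc m) f) z = of_nat (CARD('n) + m + multi_order \<gamma>) * multi_deriv \<gamma> ?g z
        + (\<Sum>j\<in>UNIV. z $ j * multi_deriv (?\<gamma> j) ?g z)"
      by (simp add: multi_deriv_euler[OF g] euler_def partial_deriv_multi_deriv[OF g])
    also have "norm \<dots> \<le> norm (of_nat (CARD('n) + m + multi_order \<gamma>) * multi_deriv \<gamma> ?g z)
        + (\<Sum>j\<in>UNIV. norm (z $ j * multi_deriv (?\<gamma> j) ?g z))"
      by (intro norm_triangle_mono order_refl norm_sum)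
    also have "\<dots> = N * norm (multi_deriv \<gamma> ?g z)
        + (\<Sum>j\<in>UNIV. norm (z $ j) * norm (multi_deriv (?\<gamma> j) ?g z))"
      unfolding norm_mult norm_of_nat N_def ..
    also have "\<dots> \<le> N * (C0 * ?X) + (\<Sum>j\<in>UNIV. C j * ?X)"
    proof (intro add_mono mult_left_mono sum_mono N)
      have "norm (multi_deriv \<gamma> ?g z) \<le> C0 * ((1 + norm z) ^ m * S (multi_order \<gamma> + m) f z)"
        using C0(2)[OF f] by (simp add: mult.assoc)
      also have "\<dots> \<le> C0 * ?X"
        by (intro mult_left_mono mult_mono power_increasing S_mono C0 S_nonneg) auto
      finally show "norm (multi_deriv \<gamma> ?g z) \<le> C0 * ?X" .
      fix j
      have "norm (z $ j) * norm (multi_deriv (?\<gamma> j) ?g z)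
          \<le> (1 + norm z) * (C j * (1 + norm z) ^ m * S (multi_order \<gamma> + Suc m) f z)"
        using Finite_Cartesian_Product.norm_nth_le[of z j] by (intro mult_mono C f) auto
      thus "norm (z $ j) * norm (multi_deriv (?\<gamma> j) ?g z) \<le> C j * ?X"
        by (simp add: mult_ac)
    qed
    also have "\<dots> = (N * C0 + sum C UNIV) * (1 + norm z) ^ Suc m * S (multi_order \<gamma> + Suc m) f z"
      by (simp only: sum_distrib_right[symmetric] distrib_right mult.assoc)
    finally show ?thesis .
  qed
  moreover have "N * C0 + sum C UNIV \<ge> 0"
    by (intro add_nonneg_nonneg mult_nonneg_nonneg sum_nonneg N C0 C)
  ultimately show ?case unfolding S_def by blast
qed

section \<open>Homogeneous expansions and the operator \<open>D_op\<close>\<close>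

lemma homogeneous_poly_sum:
  assumes "\<And>i. i \<in> I \<Longrightarrow> homogeneous_poly k (g i)"
  shows "homogeneous_poly k (\<lambda>z. \<Sum>i\<in>I. g i z)"
proof -
  obtain c where c: "\<And>i z. i \<in> I \<Longrightarrow>
      g i z = (\<Sum>\<gamma>\<in>{\<gamma>. multi_order \<gamma> = k}. c i \<gamma> * (\<Prod>j\<in>UNIV. (z $ j) ^ \<gamma> j))"
    using assms unfolding homogeneous_poly_def by metis
  show ?thesis unfolding homogeneous_poly_def
  proof (intro exI[of _ "\<lambda>\<gamma>. \<Sum>i\<in>I. c i \<gamma>"] allI)
    fix z
    have "(\<Sum>i\<in>I. g i z) = (\<Sum>i\<in>I. \<Sum>\<gamma>\<in>{\<gamma>. multi_order \<gamma> = k}. c i \<gamma> * (\<Prod>j\<in>UNIV. (z $ j) ^ \<gamma> j))"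
      by (intro sum.cong refl c)
    thus "(\<Sum>i\<in>I. g i z) = (\<Sum>\<gamma>\<in>{\<gamma>. multi_order \<gamma> = k}. (\<Sum>i\<in>I. c i \<gamma>) * (\<Prod>j\<in>UNIV. (z $ j) ^ \<gamma> j))"
      by (subst (asm) sum.swap) (simp add: sum_distrib_right)
  qed
qed

lemma homogeneous_poly_cmult:
  assumes "homogeneous_poly k g"
  shows "homogeneous_poly k (\<lambda>z. a * g z)"
proof -
  obtain c where c: "\<And>z. g z = (\<Sum>\<gamma>\<in>{\<gamma>. multi_order \<gamma> = k}. c \<gamma> * (\<Prod>j\<in>UNIV. (z $ j) ^ \<gamma> j))"
    using assms unfolding homogeneous_poly_def by metis
  show ?thesis unfolding homogeneous_poly_def
    by (intro exI[of _ "\<lambda>\<gamma>. a * c \<gamma>"]) (simp add: c sum_distrib_left mult.assoc)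
qed

lemma homogeneous_poly_coord_mult:
  fixes g :: "complex ^ 'n \<Rightarrow> complex"
  assumes "homogeneous_poly k g"
  shows "homogeneous_poly (Suc k) (\<lambda>z. z $ i * g z)"
proof -
  obtain c where c: "\<And>z. g z = (\<Sum>\<gamma>\<in>{\<gamma>. multi_order \<gamma> = k}. c \<gamma> * (\<Prod>j\<in>UNIV. (z $ j) ^ \<gamma> j))"
    using assms unfolding homogeneous_poly_def by metis
  let ?up = "\<lambda>\<gamma>. \<gamma>(i := Suc (\<gamma> i))"
  let ?dn = "\<lambda>\<gamma>. \<gamma>(i := \<gamma> i - 1)"
  show ?thesis unfolding homogeneous_poly_def
  \<comment> \<open>The case distinction guards against natural subtraction, by which
    \<open>?dn\<close> fixes a multi-index with \<open>\<gamma> i = 0\<close>.\<close>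
  proof (intro exI[of _ "\<lambda>\<gamma>. if \<gamma> i = 0 then 0 else c (?dn \<gamma>)"] allI)
    fix z :: "complex ^ 'n"
    have up: "z $ i * (\<Prod>j\<in>UNIV. (z $ j) ^ \<gamma> j) = (\<Prod>j\<in>UNIV. (z $ j) ^ (?up \<gamma>) j)" for \<gamma>
      by (simp add: prod.remove[of UNIV i] mult.assoc)
    have "z $ i * g z = (\<Sum>\<gamma>\<in>{\<gamma>. multi_order \<gamma> = k}. c \<gamma> * (z $ i * (\<Prod>j\<in>UNIV. (z $ j) ^ \<gamma> j)))"
      unfolding c sum_distrib_left by (simp only: mult.left_commute)
    also have "\<dots> = (\<Sum>\<gamma>\<in>{\<gamma>. multi_order \<gamma> = k}. c \<gamma> * (\<Prod>j\<in>UNIV. (z $ j) ^ (?up \<gamma>) j))"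
      unfolding up ..
    also have "\<dots> = (\<Sum>\<gamma>\<in>{\<gamma>. multi_order \<gamma> = Suc k \<and> \<gamma> i \<noteq> 0}. c (?dn \<gamma>) * (\<Prod>j\<in>UNIV. (z $ j) ^ \<gamma> j))"
    proof (rule sum.reindex_bij_witness[where j = ?up and i = ?dn])
      fix \<gamma> assume "\<gamma> \<in> {\<gamma>. multi_order \<gamma> = Suc k \<and> \<gamma> i \<noteq> 0}"
      thus "?dn \<gamma> \<in> {\<gamma>. multi_order \<gamma> = k}"
        using multi_order_Suc[of "?dn \<gamma>" i] by simp
    qed (auto simp: multi_order_Suc)
    also have "\<dots> = (\<Sum>\<gamma>\<in>{\<gamma>. multi_order \<gamma> = Suc k}.
        (if \<gamma> i = 0 then 0 else c (?dn \<gamma>)) * (\<Prod>j\<in>UNIV. (z $ j) ^ \<gamma> j))"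
      by (rule sum.mono_neutral_cong_left) (auto intro: finite_multi_order_eq)
    finally show "z $ i * g z = \<dots>" .
  qed
qed

lemma higher_deriv_slice_Suc:
  assumes "slice_entire f"
  shows "(deriv ^^ Suc k) (\<lambda>w. f (w *s z)) w
    = (\<Sum>i\<in>UNIV. z $ i * (deriv ^^ k) (\<lambda>w. partial_deriv i f (w *s z)) w)"
proof -
  have d: "deriv (\<lambda>w. f (w *s z)) = (\<lambda>w. \<Sum>i\<in>UNIV. z $ i * partial_deriv i f (w *s z))"
    using DERIV_imp_deriv[OF slice_entire_deriv0[OF assms]] by auto
  have hol: "(\<lambda>w. partial_deriv i f (w *s z)) holomorphic_on UNIV" for i
    by (intro slice_entire_holomorphic0 slice_entire_partial_deriv assms)
  have "(deriv ^^ k) (\<lambda>w. \<Sum>i\<in>I. z $ i * partial_deriv i f (w *s z)) w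
      = (\<Sum>i\<in>I. z $ i * (deriv ^^ k) (\<lambda>w. partial_deriv i f (w *s z)) w)" if "finite I" for I
    using that
  proof (induction I)
    case (insert i I)
    have "(deriv ^^ k) (\<lambda>w. z $ i * partial_deriv i f (w *s z) + (\<Sum>i\<in>I. z $ i * partial_deriv i f (w *s z))) w
      = (deriv ^^ k) (\<lambda>w. z $ i * partial_deriv i f (w *s z)) w + (deriv ^^ k) (\<lambda>w. \<Sum>i\<in>I. z $ i * partial_deriv i f (w *s z)) w"
      by (rule higher_deriv_add[of _ UNIV]) (auto intro!: holomorphic_intros hol)
    moreover have "(deriv ^^ k) (\<lambda>w. z $ i * partial_deriv i f (w *s z)) w = z $ i * (deriv ^^ k) (\<lambda>w. partial_deriv i f (w *s z)) w"
      by (rule higher_deriv_cmult[of _ UNIV]) (auto intro: hol)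
    ultimately show ?case using insert by simp
  qed simp
  thus ?thesis by (simp only: funpow_Suc_right o_def d finite)
qed

text \<open>Peeling off the innermost derivative leaves coordinates times derivatives of order
  \<open>k\<close> of the slices of the partial derivatives; hence the induction is over all
  \<open>f\<close>. This identifies the Taylor coefficients along lines as polynomials in the
  direction without a power series in several variables.\<close>

lemma homogeneous_poly_higher_deriv_slice:
  "slice_entire f \<Longrightarrow> homogeneous_poly k (\<lambda>z. (deriv ^^ k) (\<lambda>w. f (w *s z)) 0)"
proof (induction k arbitrary: f)
  case 0
  show ?case unfolding homogeneous_poly_def multi_order_0_iff by (intro exI[of _ "\<lambda>_. f 0"]) simp
next
  case (Suc k)
  show ?case
    unfolding higher_deriv_slice_Suc[OF Suc.prems]
    by (intro homogeneous_poly_sum homogeneous_poly_coord_mult Suc.IH slice_entire_partial_deriv Suc.prems)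
qed

lemma homogeneous_expansion_exists:
  assumes "slice_entire f"
  shows "homogeneous_expansion f (\<lambda>k z. (deriv ^^ k) (\<lambda>w. f (w *s z)) 0 / fact k)"
  unfolding homogeneous_expansion_def
proof (intro conjI allI)
  fix k
  show "homogeneous_poly k (\<lambda>z. (deriv ^^ k) (\<lambda>w. f (w *s z)) 0 / fact k)"
    using homogeneous_poly_cmult[OF homogeneous_poly_higher_deriv_slice[OF assms], of k "inverse (fact k)"]
    by (simp add: field_simps)
next
  fix z
  show "(\<lambda>k. (deriv ^^ k) (\<lambda>w. f (w *s z)) 0 / fact k) sums f z"
    \<comment> \<open>The one-variable Taylor series about 0 is evaluated at \<open>w = 1\<close>;
      the radius 2 merely puts 1 inside the disc.\<close>
    using holomorphic_power_series[of "\<lambda>w. f (w *s z)" 0 2 1] slice_entire_holomorphic0[OF assms]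
    by simp
qed

text \<open>The derivative of \<open>f (w *s z)\<close> at \<open>w = 1\<close> is computed twice:
  termwise from its power series in \<open>w\<close>, giving the factors \<open>k\<close>, and by
  the chain rule, giving the radial derivative.\<close>

lemma homogeneous_expansion_euler:
  assumes f: "slice_entire f" and F: "homogeneous_expansion f F"
  shows "homogeneous_expansion (euler c f) (\<lambda>k z. of_nat (c + k) * F k z)"
  unfolding homogeneous_expansion_def
proof (intro conjI allI)
  fix k show "homogeneous_poly k (\<lambda>z. of_nat (c + k) * F k z)"
    using F by (intro homogeneous_poly_cmult) (simp add: homogeneous_expansion_def)
next
  fix z
  have s: "(\<lambda>k. F k z * w ^ k) sums f (w *s z)" for w
  proof -
    have eq: "F k (w *s z) = F k z * w ^ k" for k
      using homogeneous_poly_scale[of k "F k" w z] F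
      unfolding homogeneous_expansion_def by (simp only: mult.commute)
    have "(\<lambda>k. F k (w *s z)) sums f (w *s z)"
      using F unfolding homogeneous_expansion_def by blast
    thus ?thesis by (simp only: eq)
  qed
  have sm: "summable (\<lambda>k. F k z * w ^ k)" for w
    using s by (rule sums_summable)
  have "((\<lambda>w. \<Sum>k. F k z * w ^ k) has_field_derivative (\<Sum>k. diffs (\<lambda>k. F k z) k * 1 ^ k)) (at 1)"
    by (rule termdiffs_strong_converges_everywhere) (rule sm)
  moreover have "(\<lambda>w. \<Sum>k. F k z * w ^ k) = (\<lambda>w. f (w *s z))"
    by (rule ext, rule sums_unique[symmetric], rule s)
  ultimately have "(\<Sum>k. diffs (\<lambda>k. F k z) k) = (\<Sum>j\<in>UNIV. z $ j * partial_deriv j f z)"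
    using DERIV_unique[OF _ slice_entire_deriv0[OF f, of z 1]] by simp
  moreover have "summable (\<lambda>k. diffs (\<lambda>k. F k z) k * 1 ^ k)"
    by (rule termdiff_converges_all) (rule sm)
  ultimately have "(\<lambda>k. diffs (\<lambda>k. F k z) k) sums (\<Sum>j\<in>UNIV. z $ j * partial_deriv j f z)"
    by (simp add: sums_iff)
  hence "(\<lambda>k. of_nat (Suc k) * F (Suc k) z) sums (\<Sum>j\<in>UNIV. z $ j * partial_deriv j f z)"
    by (simp add: diffs_def)
  hence "(\<lambda>k. of_nat k * F k z) sums (\<Sum>j\<in>UNIV. z $ j * partial_deriv j f z)"
    using sums_Suc_iff[of "\<lambda>k. of_nat k * F k z"] by simp
  from sums_add[OF sums_mult[OF s[of 1], of "of_nat c"] this]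
  show "(\<lambda>k. of_nat (c + k) * F k z) sums euler c f z"
    by (simp add: euler_def algebra_simps)
qed

lemma homogeneous_expansion_euler_prod:
  fixes f :: "complex ^ 'n \<Rightarrow> complex"
  assumes f: "slice_entire f" and F: "homogeneous_expansion f F"
  shows "homogeneous_expansion (euler_prod m f)
    (\<lambda>k z. of_real (Gamma (real (CARD('n) + m + k)) / Gamma (real (CARD('n) + k))) * F k z)"
proof (induction m)
  case 0
  have "Gamma (real (CARD('n) + k)) \<noteq> 0" for k
    by (intro Gamma_real_pos less_imp_neq[symmetric]) (simp add: add_pos_nonneg)
  thus ?case using F by simp
next
  case (Suc m)
  have nz: "real CARD('n) + real m + real k \<noteq> 0" for k
    by (simp add: add_nonneg_eq_0_iff)
  have G: "Gamma (real (CARD('n) + Suc m + k)) = real (CARD('n) + m + k) * Gamma (real (CARD('n) + m + k))" for k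
    using Gamma_plus1[of "real (CARD('n) + m + k)"]
    of_nat_in_nonpos_Ints_iff[of "CARD('n) + m + k", where 'a=real]
    by (simp add: add_ac)
  have "of_real (Gamma (real (CARD('n) + Suc m + k)) / Gamma (real (CARD('n) + k))) * F k z
     = of_nat (CARD('n) + m + k) * (of_real (Gamma (real (CARD('n) + m + k)) / Gamma (real (CARD('n) + k))) * F k z)" for k z
    unfolding G using nz by simp
  thus ?case
    using homogeneous_expansion_euler[OF slice_entire_euler_prod[OF f] Suc.IH, of "CARD('n) + m"]
    by (simp only: euler_prod.simps)
qed

lemma D_op_eq_euler_prod:
  assumes "slice_entire f"
  shows "D_op m f = euler_prod m f"
proof
  fix z
  define F where "F = (\<lambda>k z. (deriv ^^ k) (\<lambda>w. f (w *s z)) 0 / fact k)"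
  have F: "homogeneous_expansion f F"
    unfolding F_def by (rule homogeneous_expansion_exists[OF assms])
  show "D_op m f z = euler_prod m f z"
    using homogeneous_expansion_euler_prod[OF assms F, of m]
    by (simp add: D_op_def hom_part_eqI[OF F] homogeneous_expansion_def sums_unique[symmetric])
qed

section \<open>Sub-mean-value property\<close>

lemma partial_deriv_bound:
  assumes f: "slice_entire f" and r: "r > 0" and M: "\<And>w. dist w z \<le> r \<Longrightarrow> norm (f w) \<le> M"
  shows "norm (partial_deriv j f z) \<le> M / r"
proof -
  define \<phi> where "\<phi> = (\<lambda>w. f (z + w *s axis j 1))"
  have hol: "\<phi> holomorphic_on S" for S
    unfolding \<phi>_def by (rule slice_entire_holomorphic[OF f])
  have "norm ((deriv ^^ 1) \<phi> 0) \<le> fact 1 * M / r ^ 1"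
  proof (rule Cauchy_inequality)
    fix x :: complex assume "norm (0 - x) = r"
    thus "norm (\<phi> x) \<le> M" unfolding \<phi>_def
      by (intro M) (simp add: dist_norm norm_vector_scalar_mult norm_axis_1)
  qed (use r in \<open>auto intro: hol holomorphic_on_imp_continuous_on\<close>)
  thus ?thesis by (simp add: partial_deriv_slice \<phi>_def)
qed

lemma slice_entire_Lipschitz:
  assumes f: "slice_entire f" and r: "r > 0" and M: "\<And>w. dist w z0 \<le> r \<Longrightarrow> norm (f w) \<le> M"
    and z: "dist z z0 \<le> r / 2"
  shows "norm (f z - f z0) \<le> 2 * M / r * dist z z0"
proof (cases "z = z0")
  case False
  define v where "v = z - z0"
  define L where "L = norm v"
  have L: "L > 0" "L \<le> r / 2" "dist z z0 = L"
    using False z by (auto simp: L_def v_def dist_norm)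
  define \<phi> where "\<phi> = (\<lambda>w. f (z0 + w *s v))"
  have hol: "\<phi> holomorphic_on S" for S
    unfolding \<phi>_def by (rule slice_entire_holomorphic[OF f])
  \<comment> \<open>On the line through \<open>z0\<close> and \<open>z\<close>,
    \<open>\<phi>\<close> is bounded by \<open>M\<close> on the disc of radius \<open>r / L\<close>.
    Since \<open>L \<le> r / 2\<close>, half of that radius is still available around every point of
    the unit disc.\<close>
  define \<rho> where "\<rho> = r / (2 * L)"
  have \<rho>: "\<rho> > 0" "1 + \<rho> \<le> r / L" using L r by (auto simp: \<rho>_def field_simps)
  have b: "norm (\<phi> w) \<le> M" if "norm w \<le> r / L" for w
    unfolding \<phi>_def using that L
    by (intro M) (simp add: dist_norm norm_vector_scalar_mult L_def[symmetric] field_simps)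
  have d: "norm (deriv \<phi> w) \<le> M / \<rho>" if w: "w \<in> cball 0 1" for w
  proof -
    have "norm ((deriv ^^ 1) \<phi> w) \<le> fact 1 * M / \<rho> ^ 1"
    proof (rule Cauchy_inequality)
      fix x assume "norm (w - x) = \<rho>"
      thus "norm (\<phi> x) \<le> M"
        using w \<rho>(2) norm_triangle_ineq4[of w "w - x"] by (intro b) auto
    qed (use \<rho> in \<open>auto intro: hol holomorphic_on_imp_continuous_on\<close>)
    thus ?thesis by simp
  qed
  have "norm (\<phi> 1 - \<phi> 0) \<le> M / \<rho> * norm (1 - 0 :: complex)"
  proof (rule field_differentiable_bound[where S="cball 0 1" and f'="deriv \<phi>"])
    fix w show "(\<phi> has_field_derivative deriv \<phi> w) (at w within cball 0 1)"
      using holomorphic_derivI[OF hol open_UNIV UNIV_I, of w] by (rule has_field_derivative_at_within)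
  qed (use d in auto)
  thus ?thesis using L r by (simp add: \<phi>_def v_def \<rho>_def field_simps)
qed simp

text \<open>
  For \<open>p < 1\<close> the sub-mean-value property (up to a constant) does not follow from Jensen's
  inequality. Maximising \<open>(\<delta> - |z - y|)\<^sup>a |f z|\<close> with \<open>a = DIM / p\<close> produces a ball,
  of radius comparable to \<open>\<delta> - |z\<^sub>0 - y|\<close> around the maximiser \<open>z\<^sub>0\<close>, on which
  \<open>|f|\<close> is at least half of \<open>|f z\<^sub>0|\<close>.
\<close>

lemma sub_mean_value:
  fixes p :: real
  assumes p: "p > 0"
  shows "\<exists>C>0. \<forall>(f :: complex ^ 'n \<Rightarrow> complex) y \<delta>. slice_entire f \<longrightarrow> \<delta> > 0 \<longrightarrow>
    ennreal (norm (f y) powr p) \<le> ennreal (C / \<delta> ^ DIM(complex ^ 'n)) *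
      (\<integral>\<^sup>+w. ennreal (norm (f w) powr p) * indicator (ball y \<delta>) w \<partial>lborel)"
proof -
  define D where "D = DIM(complex ^ 'n)"
  have D: "D > 0" unfolding D_def by simp
  define a where "a = real D / p"
  have a: "a > 0" "a * p = D" using p D by (auto simp: a_def)
  \<comment> \<open>Chosen so that the Lipschitz bound \<open>4 * M / d\<close> with
    \<open>M = 2 powr a * norm (f z0)\<close> lets \<open>f\<close> vary by at most
    \<open>norm (f z0) / 2\<close> over distance \<open>\<eta> * d\<close>.\<close>
  define \<eta> where "\<eta> = 2 powr (-a) / 8"
  have \<eta>: "\<eta> > 0" "\<eta> \<le> 1/8" "\<eta> * 2 powr a = 1/8"
    using a ge_one_powr_ge_zero[of 2 a] by (auto simp: \<eta>_def powr_minus field_simps)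
  define V where "V = unit_ball_vol (real D)"
  have V: "V > 0" by (simp add: V_def)
  define C where "C = 2 powr p / (\<eta> ^ D * V)"
  have C: "C > 0" using \<eta> V by (simp add: C_def)
  have "ennreal (norm (f y) powr p) \<le> ennreal (C / \<delta> ^ D) *
      (\<integral>\<^sup>+w. ennreal (norm (f w) powr p) * indicator (ball y \<delta>) w \<partial>lborel)"
    if f: "slice_entire f" and \<delta>: "\<delta> > 0" for f :: "complex ^ 'n \<Rightarrow> complex" and y \<delta>
  proof (cases "f y = 0")
    case False
    define h where "h z = (\<delta> - dist z y) powr a * norm (f z)" for z
    have "continuous_on (cball y \<delta>) h"
      unfolding h_def using a
      by (intro continuous_intros continuous_on_powr' continuous_on_subset[OF slice_entire_continuous[OF f]])
        (auto simp: dist_commute)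
    moreover have "cball y \<delta> \<noteq> {}" using \<delta> by simp
    ultimately obtain z0 where z0: "z0 \<in> cball y \<delta>" "\<And>z. z \<in> cball y \<delta> \<Longrightarrow> h z \<le> h z0"
      using continuous_attains_sup[of "cball y \<delta>" h] by auto
    define d where "d = \<delta> - dist z0 y"
    have hy: "h y = \<delta> powr a * norm (f y)" by (simp add: h_def)
    have "h y > 0" using False \<delta> by (simp add: hy)
    hence hz0: "h z0 > 0" using z0(2)[of y] \<delta> by simp
    have d: "d > 0" using z0(1) hz0 a unfolding h_def d_def
      by (cases "\<delta> = dist z0 y") (auto simp: dist_commute)
    have fz0: "norm (f z0) > 0" using hz0 unfolding h_def by (auto simp: zero_less_mult_iff)
    define M where "M = 2 powr a * norm (f z0)"
    have M: "norm (f z) \<le> M" if "dist z z0 \<le> d / 2" for z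
    proof -
      \<comment> \<open>Within \<open>d / 2\<close> of the maximiser the distance to the boundary is
        at least half of \<open>d\<close>, so maximality of \<open>h\<close> costs only the factor
        \<open>2 powr a\<close>.\<close>
      have dz: "d / 2 \<le> \<delta> - dist z y" using that dist_triangle[of z y z0] by (simp add: d_def)
      hence "z \<in> cball y \<delta>" using d by (simp add: dist_commute)
      have "(d / 2) powr a * norm (f z) \<le> h z"
        unfolding h_def using dz d a by (intro mult_right_mono powr_mono2) auto
      also have "\<dots> \<le> h z0" by (rule z0) fact
      also have "\<dots> = d powr a * norm (f z0)" by (simp add: h_def d_def)
      finally have "d powr a * norm (f z) \<le> d powr a * M"
        using d by (simp add: powr_divide M_def field_simps)
      thus ?thesis using d by simp
    qed
    have lower: "norm (f z0) / 2 \<le> norm (f z)" if z: "dist z z0 \<le> \<eta> * d" for z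
    proof -
      have "\<eta> * d \<le> 1 / 8 * d" using d \<eta> by (intro mult_right_mono) auto
      hence "norm (f z - f z0) \<le> 2 * M / (d / 2) * dist z z0"
        using z d by (intro slice_entire_Lipschitz[OF f _ M]) linarith+
      also have "\<dots> \<le> 2 * M / (d / 2) * (\<eta> * d)"
        using z d by (intro mult_left_mono) (auto simp: M_def)
      also have "\<dots> = 4 * (\<eta> * 2 powr a) * norm (f z0)" using d by (simp add: M_def)
      also have "\<dots> = norm (f z0) / 2" unfolding \<eta> by simp
      finally show ?thesis using norm_triangle_ineq2[of "f z0" "f z"] by (simp add: norm_minus_commute)
    qed
    have sub: "ball z0 (\<eta> * d) \<subseteq> ball y \<delta>"
    proof
      fix z assume "z \<in> ball z0 (\<eta> * d)"
      moreover have "\<eta> * d \<le> 1 * d" using d \<eta> by (intro mult_right_mono) auto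
      ultimately show "z \<in> ball y \<delta>"
        using dist_triangle[of y z z0] by (simp add: d_def dist_commute)
    qed
    have "ennreal ((norm (f z0) / 2) powr p * (V * (\<eta> * d) ^ D))
        = (\<integral>\<^sup>+w. ennreal ((norm (f z0) / 2) powr p) * indicator (ball z0 (\<eta> * d)) w \<partial>lborel)"
      using \<eta> d by (simp add: nn_integral_cmult_indicator emeasure_ball D_def V_def ennreal_mult)
    also have "\<dots> \<le> (\<integral>\<^sup>+w. ennreal (norm (f w) powr p) * indicator (ball y \<delta>) w \<partial>lborel)"
    proof (rule nn_integral_mono)
      fix w
      show "ennreal ((norm (f z0) / 2) powr p) * indicator (ball z0 (\<eta> * d)) w
          \<le> ennreal (norm (f w) powr p) * indicator (ball y \<delta>) w"
      proof (cases "w \<in> ball z0 (\<eta> * d)")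
        case True
        hence "w \<in> ball y \<delta>" using sub by blast
        moreover have "norm (f z0) / 2 \<le> norm (f w)"
          using True by (intro lower) (simp add: dist_commute)
        ultimately show ?thesis using True p by (simp add: ennreal_leI powr_mono2)
      qed simp
    qed
    finally have *: "ennreal ((norm (f z0) / 2) powr p * (V * (\<eta> * d) ^ D))
      \<le> (\<integral>\<^sup>+w. ennreal (norm (f w) powr p) * indicator (ball y \<delta>) w \<partial>lborel)" .
    have "h y \<le> h z0" using z0(2)[of y] \<delta> by simp
    hence "h y powr p \<le> h z0 powr p" using \<open>h y > 0\<close> p by (intro powr_mono2) auto
    \<comment> \<open>Here \<open>a * p = D\<close> pays off: raising \<open>h\<close> to the power
      \<open>p\<close> turns its weights into \<open>\<delta> ^ D\<close> and \<open>d ^ D\<close>,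
      the volume factors of the two balls.\<close>
    hence "norm (f y) powr p * \<delta> ^ D \<le> norm (f z0) powr p * d ^ D"
      unfolding hy using \<delta> d a
      by (simp add: h_def d_def[symmetric] powr_mult powr_powr powr_realpow mult.commute)
    moreover have "C * ((norm (f z0) / 2) powr p * (V * (\<eta> * d) ^ D)) = norm (f z0) powr p * d ^ D"
      using \<eta> V by (simp add: C_def powr_divide power_mult_distrib field_simps)
    ultimately have "norm (f y) powr p * \<delta> ^ D \<le> C * ((norm (f z0) / 2) powr p * (V * (\<eta> * d) ^ D))"
      by simp
    hence "norm (f y) powr p \<le> C / \<delta> ^ D * ((norm (f z0) / 2) powr p * (V * (\<eta> * d) ^ D))"
      using \<delta> by (simp add: pos_le_divide_eq)
    hence "ennreal (norm (f y) powr p) \<le> ennreal (C / \<delta> ^ D) * ennreal ((norm (f z0) / 2) powr p * (V * (\<eta> * d) ^ D))"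
      using C \<delta> V by (simp add: ennreal_mult[symmetric] ennreal_leI \<eta>(1) d less_imp_le)
    also have "\<dots> \<le> ennreal (C / \<delta> ^ D) *
      (\<integral>\<^sup>+w. ennreal (norm (f w) powr p) * indicator (ball y \<delta>) w \<partial>lborel)"
      using * by (rule mult_left_mono) simp
    finally show ?thesis .
  qed simp
  with C show ?thesis unfolding D_def by blast
qed

section \<open>The weighted norms as quasi-norms\<close>

lemma ennreal_rpow_mono:
  assumes "x \<le> y" "0 < a"
  shows "ennreal_rpow x a \<le> ennreal_rpow y a"
proof (cases "y = \<infinity>")
  case False
  hence "x \<noteq> \<infinity>" "y < top" using assms(1) by (auto simp: top_unique less_top)
  thus ?thesis
    using assms False by (auto simp: ennreal_rpow_def intro!: ennreal_leI powr_mono2 enn2real_mono)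
qed (simp add: ennreal_rpow_def)

lemma ennreal_rpow_cmult:
  assumes "0 < c" "0 < a"
  shows "ennreal_rpow (ennreal c * x) a = ennreal (c powr a) * ennreal_rpow x a"
  using assms
  by (cases x) (simp_all add: ennreal_rpow_def ennreal_mult_top powr_mult ennreal_mult[symmetric])

text \<open>The sum is at most the number of terms times the largest one. This crude bound works for
  every positive exponent, with no distinction between convex and concave powers.\<close>

lemma ennreal_rpow_sum_le:
  assumes I: "finite I" and a: "0 < a"
  shows "ennreal_rpow (\<Sum>i\<in>I. x i) a \<le> ennreal (real (card I) powr a) * (\<Sum>i\<in>I. ennreal_rpow (x i) a)"
proof (cases "I = {}")
  case False
  define M where "M = Max (x ` I)"
  have M: "M \<in> x ` I" "\<And>i. i \<in> I \<Longrightarrow> x i \<le> M"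
    using I False by (auto simp: M_def)
  then obtain i0 where i0: "i0 \<in> I" "M = x i0" by auto
  have c: "real (card I) > 0" using I False by (simp add: card_gt_0_iff)
  have "(\<Sum>i\<in>I. x i) \<le> ennreal (real (card I)) * M"
    using sum_bounded_above[of I x M] M(2) by (simp add: ennreal_of_nat_eq_real_of_nat)
  hence "ennreal_rpow (\<Sum>i\<in>I. x i) a \<le> ennreal (real (card I) powr a) * ennreal_rpow M a"
    unfolding ennreal_rpow_cmult[OF c a, symmetric] by (rule ennreal_rpow_mono) (rule a)
  also have "\<dots> \<le> ennreal (real (card I) powr a) * (\<Sum>i\<in>I. ennreal_rpow (x i) a)"
    unfolding i0(2) using i0(1) I by (intro mult_left_mono member_le_sum) auto
  finally show ?thesis .
qed (simp add: ennreal_rpow_def)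

lemma powr_sum_le:
  fixes x :: "'i \<Rightarrow> real"
  assumes I: "finite I" and q: "0 < q" and x: "\<And>i. i \<in> I \<Longrightarrow> x i \<ge> 0"
  shows "(\<Sum>i\<in>I. x i) powr q \<le> real (card I) powr q * (\<Sum>i\<in>I. x i powr q)"
proof (cases "I = {}")
  case False
  define M where "M = Max (x ` I)"
  have M: "M \<in> x ` I" "\<And>i. i \<in> I \<Longrightarrow> x i \<le> M"
    using I False by (auto simp: M_def)
  then obtain i0 where i0: "i0 \<in> I" "M = x i0" by auto
  have "(\<Sum>i\<in>I. x i) powr q \<le> (real (card I) * M) powr q"
    using sum_bounded_above[of I x M] M(2) x q by (intro powr_mono2) (auto intro: sum_nonneg)
  also have "\<dots> = real (card I) powr q * x i0 powr q"
    by (simp add: i0(2) powr_mult)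
  also have "\<dots> \<le> real (card I) powr q * (\<Sum>i\<in>I. x i powr q)"
    using i0(1) I by (intro mult_left_mono member_le_sum) auto
  finally show ?thesis .
qed simp

section \<open>Integration against \<open>dV\<close> and passage to suprema\<close>

lemma sets_dV [measurable_cong]: "sets dV = sets lebesgue"
  by (simp add: dV_def)

lemma space_dV [simp]: "space dV = UNIV"
  by (simp add: dV_def space_scale_measure)

lemma borel_measurable_dV: "h \<in> borel_measurable borel \<Longrightarrow> h \<in> borel_measurable dV"
  unfolding measurable_cong_sets[OF sets_dV refl] by (rule measurable_completion) simp

lemma nn_integral_dV:
  fixes h :: "complex ^ 'n \<Rightarrow> ennreal"
  assumes "h \<in> borel_measurable borel"
  shows "(\<integral>\<^sup>+z. h z \<partial>dV) = ennreal (1 / pi ^ CARD('n)) * (\<integral>\<^sup>+z. h z \<partial>lborel)"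
proof -
  have "h \<in> borel_measurable lebesgue"
    by (rule measurable_completion) (simp add: assms)
  thus ?thesis
    by (simp add: dV_def nn_integral_scale_measure nn_integral_completion assms)
qed

definition weighted_integral :: "real \<Rightarrow> real \<Rightarrow> (complex ^ 'n \<Rightarrow> complex) \<Rightarrow> ennreal" where
  "weighted_integral q \<alpha> \<psi> =
    (\<integral>\<^sup>+z. ennreal ((norm (\<psi> z) * exp (- (norm z)\<^sup>2 / 2)) powr q * (1 + norm z) powr (- \<alpha>)) \<partial>dV)"

text \<open>
  For \<open>p = \<infinity>\<close> the essential supremum is replaced by the supremum. The two agree for
  continuous functions, but the supremum needs no measurability.
\<close>

definition S_norm :: "ennreal \<Rightarrow> real \<Rightarrow> (complex ^ 'n \<Rightarrow> complex) \<Rightarrow> ennreal" where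
  "S_norm p \<alpha> \<psi> =
    (if p = \<infinity> then (SUP z. ennreal (norm (\<psi> z) * exp (- (norm z)\<^sup>2 / 2) / (1 + norm z) powr \<alpha>))
     else ennreal_rpow (weighted_integral (enn2real p) \<alpha> \<psi>) (1 / enn2real p))"

lemma emeasure_dV_open_pos:
  fixes U :: "(complex ^ 'n) set"
  assumes "open U" "U \<noteq> {}"
  shows "emeasure dV U \<noteq> 0"
proof -
  have "emeasure lebesgue U \<noteq> 0"
    using open_not_negligible[OF assms] assms(1)
    by (auto simp: negligible_iff_null_sets null_sets_def)
  thus ?thesis by (simp add: dV_def)
qed

text \<open>If some value exceeded the essential supremum, the set of such points would be open and
  nonempty, hence of positive measure.\<close>

lemma esssup_dV_continuous:
  fixes h :: "complex ^ 'n \<Rightarrow> real"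
  assumes h: "continuous_on UNIV h"
  shows "esssup dV (\<lambda>z. ennreal (h z)) = (SUP z. ennreal (h z))"
proof (rule antisym)
  have "h \<in> borel_measurable borel" using h by (rule borel_measurable_continuous_onI)
  hence m: "(\<lambda>z. ennreal (h z)) \<in> borel_measurable dV"
    by (intro borel_measurable_dV) auto
  show "esssup dV (\<lambda>z. ennreal (h z)) \<le> (SUP z. ennreal (h z))"
    by (intro esssup_I m AE_I2 SUP_upper) auto
  show "(SUP z. ennreal (h z)) \<le> esssup dV (\<lambda>z. ennreal (h z))"
  proof (rule SUP_least, rule ccontr)
    fix z
    let ?e = "esssup dV (\<lambda>z. ennreal (h z))"
    assume "\<not> ennreal (h z) \<le> ?e"
    hence lt: "?e < ennreal (h z)" by simp
    then obtain e where e: "?e = ennreal e" "e \<ge> 0" by (cases ?e) auto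
    have "{x. ennreal (h x) > ?e} = {x. h x > e}" using e by (auto simp: ennreal_less_iff)
    moreover have "open {x. h x > e}" using h by (intro open_Collect_less) auto
    moreover have "z \<in> {x. h x > e}" using lt e by (auto simp: ennreal_less_iff)
    ultimately have "emeasure dV {x. ennreal (h x) > ?e} \<noteq> 0"
      by (intro emeasure_dV_open_pos) auto
    thus False using esssup_zero_measure[of dV "\<lambda>z. ennreal (h z)"] by simp
  qed
qed

lemma L_norm_eq_S_norm:
  assumes "continuous_on UNIV \<psi>"
  shows "L_norm p \<alpha> \<psi> = S_norm p \<alpha> \<psi>"
proof (cases "p = \<infinity>")
  case True
  have "1 + norm z \<noteq> 0" for z :: "complex ^ 'a"
    using norm_ge_zero[of z] by linarith
  hence "continuous_on UNIV (\<lambda>z. norm (\<psi> z) * exp (- (norm z)\<^sup>2 / 2) / (1 + norm z) powr \<alpha>)"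
    by (intro continuous_intros assms continuous_on_divide) auto
  from esssup_dV_continuous[OF this] show ?thesis by (simp add: L_norm_def S_norm_def True)
qed (simp add: L_norm_def S_norm_def weighted_integral_def)

text \<open>For finite \<open>p\<close> a sum of \<open>n\<close> terms loses twice: a factor
  \<open>n\<close> when the pointwise sum is raised to the power \<open>p\<close>, and
  \<open>n powr (1 / p)\<close> when the root is taken of the sum of integrals.\<close>

definition quasi_const :: "ennreal \<Rightarrow> nat \<Rightarrow> real" where
  "quasi_const p n = (if p = \<infinity> then 1 else real n powr (1 + 1 / enn2real p))"

lemma quasi_const_pos: "n > 0 \<Longrightarrow> quasi_const p n > 0"
  by (simp add: quasi_const_def)

lemma enn2real_pos_finite: "0 < p \<Longrightarrow> p \<noteq> \<infinity> \<Longrightarrow> 0 < enn2real p"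
  by (simp add: enn2real_positive_iff less_top)

lemma S_norm_sum_le:
  fixes \<psi> :: "complex ^ 'n \<Rightarrow> complex"
  assumes p: "p > 0" and C: "C > 0" and I: "finite I" "I \<noteq> {}"
    and meas: "\<And>i. i \<in> I \<Longrightarrow> \<phi> i \<in> borel_measurable borel"
    and le: "\<And>z. norm (\<psi> z) \<le> C * (\<Sum>i\<in>I. norm (\<phi> i z))"
  shows "S_norm p \<alpha> \<psi> \<le> ennreal (C * quasi_const p (card I)) * (\<Sum>i\<in>I. S_norm p \<alpha> (\<phi> i))"
proof (cases "p = \<infinity>")
  case True
  define W where "W z = exp (- (norm z)\<^sup>2 / 2) / (1 + norm z) powr \<alpha>" for z :: "complex ^ 'n"
  have W: "W z \<ge> 0" for z by (simp add: W_def)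
  have S: "S_norm p \<alpha> \<psi> = (SUP z. ennreal (norm (\<psi> z) * W z))" for \<psi> :: "complex ^ 'n \<Rightarrow> complex"
    by (simp add: S_norm_def True W_def)
  have "ennreal (norm (\<psi> z) * W z) \<le> ennreal C * (\<Sum>i\<in>I. S_norm p \<alpha> (\<phi> i))" for z
  proof -
    have "norm (\<psi> z) * W z \<le> C * (\<Sum>i\<in>I. norm (\<phi> i z)) * W z"
      by (intro mult_right_mono le W)
    hence "ennreal (norm (\<psi> z) * W z) \<le> ennreal (C * (\<Sum>i\<in>I. norm (\<phi> i z) * W z))"
      by (simp only: ennreal_leI sum_distrib_right mult.assoc)
    also have "\<dots> = ennreal C * (\<Sum>i\<in>I. ennreal (norm (\<phi> i z) * W z))"
      using C W by (subst ennreal_mult) (auto intro!: sum_nonneg)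
    also have "\<dots> \<le> ennreal C * (\<Sum>i\<in>I. S_norm p \<alpha> (\<phi> i))"
      unfolding S by (intro mult_left_mono sum_mono SUP_upper) auto
    finally show ?thesis .
  qed
  thus ?thesis unfolding S[of \<psi>] quasi_const_def using True by (simp add: SUP_le_iff)
next
  case False
  define q where "q = enn2real p"
  have q: "q > 0" using p False by (simp add: q_def enn2real_pos_finite)
  define n where "n = real (card I)"
  have n: "n > 0" using I by (simp add: n_def card_gt_0_iff)
  define E where "E z = exp (- (norm z)\<^sup>2 / 2)" for z :: "complex ^ 'n"
  define W where "W z = (1 + norm z) powr (- \<alpha>)" for z :: "complex ^ 'n"
  have E: "E z \<ge> 0" "W z \<ge> 0" for z by (simp_all add: E_def W_def)
  have wi: "weighted_integral q \<alpha> \<psi> = (\<integral>\<^sup>+z. ennreal ((norm (\<psi> z) * E z) powr q * W z) \<partial>dV)"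
    for \<psi> :: "complex ^ 'n \<Rightarrow> complex"
    by (simp add: weighted_integral_def E_def W_def)
  have m: "(\<lambda>z. ennreal ((norm (\<phi> i z) * E z) powr q * W z)) \<in> borel_measurable dV" if "i \<in> I" for i
  proof (rule borel_measurable_dV)
    note [measurable] = meas[OF that]
    show "(\<lambda>z. ennreal ((norm (\<phi> i z) * E z) powr q * W z)) \<in> borel_measurable borel"
      unfolding E_def W_def by measurable
  qed
  have pt: "(norm (\<psi> z) * E z) powr q * W z \<le> (C * n) powr q * (\<Sum>i\<in>I. (norm (\<phi> i z) * E z) powr q * W z)" for z
  proof -
    have "(norm (\<psi> z) * E z) powr q \<le> (C * (\<Sum>i\<in>I. norm (\<phi> i z) * E z)) powr q"
      using mult_right_mono[OF le E(1)[of z], of z] q E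
      by (intro powr_mono2) (auto simp: sum_distrib_right mult.assoc)
    also have "\<dots> = C powr q * (\<Sum>i\<in>I. norm (\<phi> i z) * E z) powr q"
      by (rule powr_mult)
    also have "\<dots> \<le> C powr q * (n powr q * (\<Sum>i\<in>I. (norm (\<phi> i z) * E z) powr q))"
      unfolding n_def using E by (intro mult_left_mono powr_sum_le I q) auto
    finally have "(norm (\<psi> z) * E z) powr q * W z \<le> C powr q * (n powr q * (\<Sum>i\<in>I. (norm (\<phi> i z) * E z) powr q)) * W z"
      by (intro mult_right_mono E)
    thus ?thesis by (simp only: powr_mult mult.assoc sum_distrib_right)
  qed
  have "weighted_integral q \<alpha> \<psi> \<le> (\<integral>\<^sup>+z. ennreal ((C * n) powr q) * (\<Sum>i\<in>I. ennreal ((norm (\<phi> i z) * E z) powr q * W z)) \<partial>dV)"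
    unfolding wi
  proof (rule nn_integral_mono)
    fix z
    have "ennreal ((norm (\<psi> z) * E z) powr q * W z)
        \<le> ennreal ((C * n) powr q * (\<Sum>i\<in>I. (norm (\<phi> i z) * E z) powr q * W z))"
      by (intro ennreal_leI pt)
    also have "\<dots> = ennreal ((C * n) powr q) * (\<Sum>i\<in>I. ennreal ((norm (\<phi> i z) * E z) powr q * W z))"
      using E by (subst ennreal_mult) (auto intro!: sum_nonneg)
    finally show "ennreal ((norm (\<psi> z) * E z) powr q * W z) \<le> \<dots>" .
  qed
  also have "\<dots> = ennreal ((C * n) powr q) * (\<Sum>i\<in>I. weighted_integral q \<alpha> (\<phi> i))"
    unfolding wi by (subst nn_integral_cmult, rule borel_measurable_sum) (auto simp: m nn_integral_sum)
  finally have "S_norm p \<alpha> \<psi> \<le> ennreal_rpow (ennreal ((C * n) powr q) * (\<Sum>i\<in>I. weighted_integral q \<alpha> (\<phi> i))) (1 / q)"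
    using False q by (simp add: S_norm_def q_def[symmetric] ennreal_rpow_mono)
  also have "\<dots> = ennreal (C * n) * ennreal_rpow (\<Sum>i\<in>I. weighted_integral q \<alpha> (\<phi> i)) (1 / q)"
    using C n q by (subst ennreal_rpow_cmult) (auto simp: powr_powr)
  also have "\<dots> \<le> ennreal (C * n) * (ennreal (n powr (1 / q)) * (\<Sum>i\<in>I. ennreal_rpow (weighted_integral q \<alpha> (\<phi> i)) (1 / q)))"
    unfolding n_def using q by (intro mult_left_mono ennreal_rpow_sum_le I) auto
  also have "\<dots> = ennreal (C * quasi_const p (card I)) * (\<Sum>i\<in>I. S_norm p \<alpha> (\<phi> i))"
    using False C n q
    by (simp add: S_norm_def q_def[symmetric] quasi_const_def n_def[symmetric] powr_add
        ennreal_mult mult.assoc)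
  finally show ?thesis .
qed

lemma S_norm_mono:
  assumes p: "p > 0" and C: "C > 0" and meas: "\<phi> \<in> borel_measurable borel"
    and le: "\<And>z. norm (\<psi> z) \<le> C * norm (\<phi> z)"
  shows "S_norm p \<alpha> \<psi> \<le> ennreal C * S_norm p \<alpha> \<phi>"
  using S_norm_sum_le[OF p C, of "{()}" "\<lambda>_. \<phi>" \<psi> \<alpha>] meas le by (simp add: quasi_const_def split: if_split_asm)

text \<open>
  A factor \<open>(1 + |z|) powr s\<close> in the function amounts to this shift of \<open>\<alpha>\<close>; for finite \<open>p\<close> the
  factor is raised to the power \<open>p\<close>, whereas the weight in \<^const>\<open>L_norm\<close> is not.
\<close>

definition weight_shift :: "ennreal \<Rightarrow> real \<Rightarrow> real" where
  "weight_shift p s = s * (if p = \<infinity> then 1 else enn2real p)"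

lemma S_norm_weight:
  "S_norm p \<alpha> (\<lambda>z. of_real ((1 + norm z) powr s) * \<psi> z) = S_norm p (\<alpha> - weight_shift p s) \<psi>"
proof (cases "p = \<infinity>")
  case True
  have "1 + norm z > 0" for z :: "complex ^ 'a"
    using norm_ge_zero[of z] by linarith
  thus ?thesis
    by (simp add: S_norm_def True weight_shift_def norm_mult powr_diff field_simps)
next
  case False
  have "(norm (of_real ((1 + norm z) powr s) * \<psi> z) * e) powr q * (1 + norm z) powr (- \<alpha>)
      = (norm (\<psi> z) * e) powr q * (1 + norm z) powr (- (\<alpha> - s * q))" for q e and z :: "complex ^ 'a"
    by (simp add: norm_mult powr_mult powr_powr powr_add[symmetric] mult_ac add_ac)
  thus ?thesis
    using False by (simp add: S_norm_def weight_shift_def weighted_integral_def)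
qed

section \<open>Averaging over small balls\<close>

lemma powr_comparable:
  fixes x y k b :: real
  assumes "x > 0" "y > 0" "x \<le> k * y" "y \<le> k * x" "k \<ge> 1"
  shows "x powr b \<le> k powr \<bar>b\<bar> * y powr b"
proof (cases "b \<ge> 0")
  case True
  have "x powr b \<le> (k * y) powr b" using assms True by (intro powr_mono2) auto
  thus ?thesis using True by (simp add: powr_mult)
next
  case False
  have "y / k \<le> x" using assms by (simp add: field_simps)
  hence "x powr b \<le> (y / k) powr b" using assms False by (intro powr_mono2') auto
  also have "\<dots> = k powr \<bar>b\<bar> * y powr b"
    using assms False by (simp add: powr_divide powr_minus field_simps)
  finally show ?thesis .
qed

lemma one_plus_norm_comparable:
  fixes w z :: "'a :: real_normed_vector"
  assumes "dist w z \<le> K / (1 + norm z)" "K \<ge> 0"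
  shows "1 + norm w \<le> (1 + K) * (1 + norm z)" "1 + norm z \<le> (1 + K) * (1 + norm w)"
proof -
  have "K / (1 + norm z) \<le> K / 1" using assms(2) by (intro divide_left_mono) (auto intro: add_pos_nonneg)
  hence d: "norm (w - z) \<le> K" using assms(1) by (simp add: dist_norm)
  have "norm w \<le> norm z + K" "norm z \<le> norm w + K"
    using d norm_triangle_sub[of w z] norm_triangle_sub[of z w] by (auto simp: norm_minus_commute)
  moreover have "0 \<le> K * norm z" "0 \<le> K * norm w" using assms(2) by auto
  ultimately show "1 + norm w \<le> (1 + K) * (1 + norm z)" "1 + norm z \<le> (1 + K) * (1 + norm w)"
    unfolding distrib_left distrib_right mult_1 mult_1_right by linarith+
qed

text \<open>
  The real parameter \<open>\<theta>\<close> may have either sign: it is negative when \<open>y\<close> is just a point near \<open>z\<close>,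
  and positive when \<open>y\<close> lies further inside, which yields a gain in the Gaussian weight.
\<close>

definition dominated ::
    "real \<Rightarrow> real \<Rightarrow> (complex ^ 'n) set \<Rightarrow> (complex ^ 'n \<Rightarrow> complex) \<Rightarrow> (complex ^ 'n \<Rightarrow> complex) \<Rightarrow> bool" where
  "dominated K \<theta> S f \<psi> \<longleftrightarrow> (\<forall>z. \<psi> z = 0 \<or> (\<exists>y. norm (\<psi> z) \<le> norm (f y) \<and>
     (\<forall>w\<in>ball y (1 / (1 + norm z)).
        w \<in> S \<and> dist w z \<le> K / (1 + norm z) \<and> (norm w)\<^sup>2 \<le> (norm z)\<^sup>2 - \<theta>)))"

text \<open>The sub-mean-value property is applied at \<open>y\<close>, the weights are moved from
  \<open>z\<close> to \<open>w\<close>, and the order of integration is exchanged. The point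
  \<open>y\<close> may depend on \<open>z\<close> in a non-measurable way, so before integrating in
  \<open>z\<close> the ball about \<open>y\<close> is enlarged to a closed relation between
  \<open>z\<close> and \<open>w\<close> that no longer mentions \<open>y\<close>.\<close>

lemma weighted_integral_average:
  fixes q \<alpha> :: real
  assumes q: "q > 0"
  shows "\<exists>C>0. \<forall>K \<theta> S (f :: complex ^ 'n \<Rightarrow> complex) \<psi>.
    slice_entire f \<longrightarrow> K \<ge> 0 \<longrightarrow> S \<in> sets borel \<longrightarrow> dominated K \<theta> S f \<psi> \<longrightarrow>
    weighted_integral q \<alpha> \<psi> \<le>
      ennreal (C * (1 + K) powr (3 * DIM(complex ^ 'n) + \<bar>\<alpha>\<bar>) * exp (- q * \<theta> / 2)) *
      weighted_integral q \<alpha> (\<lambda>z. if z \<in> S then f z else 0)"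
proof -
  define D where "D = DIM(complex ^ 'n)"
  define V where "V = unit_ball_vol (real D)"
  have V: "V > 0" by (simp add: V_def)
  obtain C1 where C1: "C1 > 0" and smv: "\<And>(f :: complex ^ 'n \<Rightarrow> complex) y \<delta>. slice_entire f \<Longrightarrow> \<delta> > 0 \<Longrightarrow>
    ennreal (norm (f y) powr q) \<le> ennreal (C1 / \<delta> ^ D) *
      (\<integral>\<^sup>+w. ennreal (norm (f w) powr q) * indicator (ball y \<delta>) w \<partial>lborel)"
    using sub_mean_value[OF q, where 'n='n] unfolding D_def by blast
  define W where "W z = exp (- q * (norm z)\<^sup>2 / 2) * (1 + norm z) powr (- \<alpha>)" for z :: "complex ^ 'n"
  have W: "W z \<ge> 0" for z by (simp add: W_def)
  have meas_W [measurable]: "W \<in> borel_measurable borel" unfolding W_def by measurable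
  have pos: "1 + norm z > 0" for z :: "complex ^ 'n" using norm_ge_zero[of z] by linarith
  have wi: "weighted_integral q \<alpha> \<psi> = (\<integral>\<^sup>+z. ennreal (norm (\<psi> z) powr q * W z) \<partial>dV)"
    for \<psi> :: "complex ^ 'n \<Rightarrow> complex"
    unfolding weighted_integral_def W_def
    by (intro nn_integral_cong) (simp add: powr_mult exp_powr_real mult.assoc mult.commute)
  have "weighted_integral q \<alpha> \<psi> \<le>
      ennreal (C1 * V * (1 + K) powr (3 * D + \<bar>\<alpha>\<bar>) * exp (- q * \<theta> / 2)) *
      weighted_integral q \<alpha> (\<lambda>z. if z \<in> S then f z else 0)"
    if f: "slice_entire f" and K: "K \<ge> 0" and S [measurable]: "S \<in> sets borel" and dom: "dominated K \<theta> S f \<psi>"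
    for K \<theta> S and f \<psi> :: "complex ^ 'n \<Rightarrow> complex"
  proof -
    have [measurable]: "f \<in> borel_measurable borel"
      using slice_entire_continuous[OF f] by (rule borel_measurable_continuous_onI)
    define k where "k = 1 + K"
    have k: "k \<ge> 1" using K by (simp add: k_def)
    define H where "H w = ennreal (norm (if w \<in> S then f w else 0) powr q * W w)" for w
    have [measurable]: "H \<in> borel_measurable borel" unfolding H_def by measurable
    define c where "c = C1 * k ^ D * k powr \<bar>\<alpha>\<bar> * exp (- q * \<theta> / 2)"
    have c: "c \<ge> 0" using C1 k by (simp add: c_def)
    \<comment> \<open>Closeness is measured at the scale of \<open>w\<close> instead of
      \<open>z\<close>, so that for fixed \<open>w\<close> the admissible \<open>z\<close> form a
      ball of explicit volume.\<close>
    define N where "N = {(z :: complex ^ 'n, w). dist w z * (1 + norm w) \<le> K * k}"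
    have "closed N" unfolding N_def case_prod_unfold by (intro closed_Collect_le continuous_intros)
    hence N [measurable]: "N \<in> sets (borel \<Otimes>\<^sub>M borel)" unfolding borel_prod by simp
    define G where "G z w = ennreal ((1 + norm w) ^ D) * H w * indicator N (z, w)" for z w
    have G [measurable]: "case_prod G \<in> borel_measurable (borel \<Otimes>\<^sub>M borel)"
      unfolding G_def case_prod_unfold by measurable
    have pt: "ennreal (norm (\<psi> z) powr q * W z) \<le> ennreal c * (\<integral>\<^sup>+w. G z w \<partial>lborel)" for z
    proof (cases "\<psi> z = 0")
      case False
      define \<delta> where "\<delta> = 1 / (1 + norm z)"
      have \<delta>: "\<delta> > 0" using pos[of z] by (simp add: \<delta>_def)
      obtain y where y: "norm (\<psi> z) \<le> norm (f y)" "\<And>w. w \<in> ball y \<delta> \<Longrightarrow> w \<in> S"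
        "\<And>w. w \<in> ball y \<delta> \<Longrightarrow> dist w z \<le> K / (1 + norm z)"
        "\<And>w. w \<in> ball y \<delta> \<Longrightarrow> (norm w)\<^sup>2 \<le> (norm z)\<^sup>2 - \<theta>"
        using dom False unfolding dominated_def \<delta>_def by blast
      have "ennreal (norm (\<psi> z) powr q * W z) \<le> ennreal (W z) * ennreal (norm (f y) powr q)"
        using y(1) q W
        by (subst ennreal_mult[symmetric]) (auto intro!: ennreal_leI mult_left_mono powr_mono2 simp: mult.commute[of _ "W z"])
      also have "\<dots> \<le> ennreal (W z) * (ennreal (C1 / \<delta> ^ D) *
          (\<integral>\<^sup>+w. ennreal (norm (f w) powr q) * indicator (ball y \<delta>) w \<partial>lborel))"
        by (intro mult_left_mono smv f \<delta>) simp
      also have "\<dots> = (\<integral>\<^sup>+w. ennreal (W z * (C1 / \<delta> ^ D)) * (ennreal (norm (f w) powr q) * indicator (ball y \<delta>) w) \<partial>lborel)"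
      proof -
        have [measurable]: "ball y \<delta> \<in> sets borel" by simp
        have m: "(\<lambda>w. ennreal (norm (f w) powr q) * indicator (ball y \<delta>) w) \<in> borel_measurable lborel"
          by measurable
        have "ennreal (W z * (C1 / \<delta> ^ D)) = ennreal (W z) * ennreal (C1 / \<delta> ^ D)"
          using W C1 \<delta> by (intro ennreal_mult) auto
        thus ?thesis unfolding nn_integral_cmult[OF m] by (simp only: mult.assoc)
      qed
      also have "\<dots> \<le> (\<integral>\<^sup>+w. ennreal c * G z w \<partial>lborel)"
      proof (rule nn_integral_mono)
        fix w
        show "ennreal (W z * (C1 / \<delta> ^ D)) * (ennreal (norm (f w) powr q) * indicator (ball y \<delta>) w) \<le> ennreal c * G z w"
        proof (cases "w \<in> ball y \<delta>")
          case True
          note w = y(2-4)[OF True]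
          note cmp = one_plus_norm_comparable[OF w(2) K, folded k_def]
          have "dist w z * (1 + norm w) \<le> K / (1 + norm z) * (k * (1 + norm z))"
            using w(2) cmp(1) pos[of w] K pos[of z] by (intro mult_mono) auto
          also have "\<dots> = K * k" using pos[of z] by simp
          finally have inN: "(z, w) \<in> N" by (simp add: N_def)
          \<comment> \<open>The gain \<theta> in the squared norm enters here, as an exponential
            factor.\<close>
          have "exp (- q * (norm z)\<^sup>2 / 2) \<le> exp (- q * \<theta> / 2) * exp (- q * (norm w)\<^sup>2 / 2)"
            using mult_left_mono[OF w(3), of q] q by (simp add: exp_add[symmetric] field_simps)
          moreover have "(1 + norm z) powr (-\<alpha>) \<le> k powr \<bar>\<alpha>\<bar> * (1 + norm w) powr (-\<alpha>)"
            using powr_comparable[OF pos[of z] pos[of w] cmp(2) cmp(1) k, of "-\<alpha>"] by simp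
          ultimately have Wz: "W z \<le> (exp (- q * \<theta> / 2) * exp (- q * (norm w)\<^sup>2 / 2)) * (k powr \<bar>\<alpha>\<bar> * (1 + norm w) powr (-\<alpha>))"
            unfolding W_def by (intro mult_mono) auto
          have "(1 + norm z) ^ D \<le> (k * (1 + norm w)) ^ D"
            using cmp(2) pos[of z] by (intro power_mono) auto
          hence d: "C1 / \<delta> ^ D \<le> C1 * (k ^ D * (1 + norm w) ^ D)"
            using C1 by (simp add: \<delta>_def power_divide power_mult_distrib)
          have "W z * (C1 / \<delta> ^ D) \<le> ((exp (- q * \<theta> / 2) * exp (- q * (norm w)\<^sup>2 / 2)) * (k powr \<bar>\<alpha>\<bar> * (1 + norm w) powr (-\<alpha>)))
              * (C1 * (k ^ D * (1 + norm w) ^ D))"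
            using W C1 \<delta> by (intro mult_mono Wz d) auto
          also have "\<dots> = c * ((1 + norm w) ^ D * W w)" by (simp add: c_def W_def mult_ac)
          finally have "W z * (C1 / \<delta> ^ D) * norm (f w) powr q \<le> c * ((1 + norm w) ^ D * W w) * norm (f w) powr q"
            by (rule mult_right_mono) simp
          hence "ennreal (W z * (C1 / \<delta> ^ D) * norm (f w) powr q) \<le> ennreal (c * ((1 + norm w) ^ D * (norm (f w) powr q * W w)))"
            by (intro ennreal_leI) (simp only: mult_ac)
          also have "\<dots> = ennreal c * (ennreal ((1 + norm w) ^ D) * ennreal (norm (f w) powr q * W w))"
            using c W pos[of w] by (simp only: ennreal_mult mult_nonneg_nonneg zero_le_power less_imp_le powr_ge_zero)
          finally have le: "ennreal (W z * (C1 / \<delta> ^ D) * norm (f w) powr q) \<le> \<dots>" .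
          have "ennreal (W z * (C1 / \<delta> ^ D)) * (ennreal (norm (f w) powr q) * indicator (ball y \<delta>) w)
              = ennreal (W z * (C1 / \<delta> ^ D) * norm (f w) powr q)"
            using True W[of z] C1 \<delta> by (subst ennreal_mult) auto
          moreover have "G z w = ennreal ((1 + norm w) ^ D) * ennreal (norm (f w) powr q * W w)"
            using inN w(1) by (simp add: G_def H_def)
          ultimately show ?thesis using le by simp
        qed simp
      qed
      also have "\<dots> = ennreal c * (\<integral>\<^sup>+w. G z w \<partial>lborel)"
        by (rule nn_integral_cmult) simp
      finally show ?thesis .
    qed (use q in simp)
    \<comment> \<open>The volume of the \<open>z\<close>-section, of order
      \<open>(1 + norm w) ^ (- D)\<close>, cancels the factor \<open>(1 + norm w) ^ D\<close> left
      by the averaging radius.\<close>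
    have inner: "(\<integral>\<^sup>+z. G z w \<partial>lborel) \<le> ennreal (V * (K * k) ^ D) * H w" for w
    proof -
      let ?r = "K * k / (1 + norm w)"
      have r: "?r \<ge> 0" using K k pos[of w] by simp
      have "(\<integral>\<^sup>+z. G z w \<partial>lborel) = (\<integral>\<^sup>+z. (ennreal ((1 + norm w) ^ D) * H w) * indicator (cball w ?r) z \<partial>lborel)"
        unfolding G_def N_def using pos[of w]
        by (intro nn_integral_cong) (auto simp: indicator_def pos_le_divide_eq)
      also have "\<dots> = (ennreal ((1 + norm w) ^ D) * H w) * ennreal (V * ?r ^ D)"
        using r by (subst nn_integral_cmult_indicator) (simp_all add: emeasure_cball V_def D_def)
      also have "\<dots> = ennreal ((1 + norm w) ^ D * (V * ?r ^ D)) * H w"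
        using r V pos[of w] by (simp add: ennreal_mult mult_ac)
      also have "(1 + norm w) ^ D * (V * ?r ^ D) = V * (K * k) ^ D"
        using pos[of w] by (simp add: power_divide)
      finally show ?thesis by simp
    qed
    have "weighted_integral q \<alpha> \<psi> \<le> (\<integral>\<^sup>+z. ennreal c * (\<integral>\<^sup>+w. G z w \<partial>lborel) \<partial>dV)"
      unfolding wi by (rule nn_integral_mono) (rule pt)
    also have "\<dots> = ennreal (1 / pi ^ CARD('n)) * (\<integral>\<^sup>+z. ennreal c * (\<integral>\<^sup>+w. G z w \<partial>lborel) \<partial>lborel)"
      by (rule nn_integral_dV) measurable
    also have "(\<integral>\<^sup>+z. ennreal c * (\<integral>\<^sup>+w. G z w \<partial>lborel) \<partial>lborel) = ennreal c * (\<integral>\<^sup>+z. \<integral>\<^sup>+w. G z w \<partial>lborel \<partial>lborel)"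
      by (rule nn_integral_cmult) measurable
    also have "(\<integral>\<^sup>+z. \<integral>\<^sup>+w. G z w \<partial>lborel \<partial>lborel) = (\<integral>\<^sup>+w. \<integral>\<^sup>+z. G z w \<partial>lborel \<partial>lborel)"
      by (rule lborel_pair.Fubini'[symmetric]) measurable
    also have "\<dots> \<le> (\<integral>\<^sup>+w. ennreal (V * (K * k) ^ D) * H w \<partial>lborel)"
      by (rule nn_integral_mono) (rule inner)
    also have "\<dots> = ennreal (V * (K * k) ^ D) * (\<integral>\<^sup>+w. H w \<partial>lborel)"
      by (rule nn_integral_cmult) measurable
    finally have "weighted_integral q \<alpha> \<psi> \<le> ennreal (1 / pi ^ CARD('n)) * (ennreal c * (ennreal (V * (K * k) ^ D) * (\<integral>\<^sup>+w. H w \<partial>lborel)))"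
      by (simp add: mult_left_mono)
    also have "\<dots> = ennreal (c * (V * (K * k) ^ D)) * (ennreal (1 / pi ^ CARD('n)) * (\<integral>\<^sup>+w. H w \<partial>lborel))"
      using c V K k by (simp add: ennreal_mult mult_ac)
    also have "ennreal (1 / pi ^ CARD('n)) * (\<integral>\<^sup>+w. H w \<partial>lborel) = (\<integral>\<^sup>+w. H w \<partial>dV)"
      by (rule nn_integral_dV[symmetric]) measurable
    also have "(\<integral>\<^sup>+w. H w \<partial>dV) = weighted_integral q \<alpha> (\<lambda>z. if z \<in> S then f z else 0)"
      unfolding wi H_def ..
    also have "ennreal (c * (V * (K * k) ^ D)) \<le> ennreal (C1 * V * (1 + K) powr (3 * D + \<bar>\<alpha>\<bar>) * exp (- q * \<theta> / 2))"
    proof (rule ennreal_leI)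
      \<comment> \<open>Of the \<open>3 * D\<close> powers of \<open>k\<close>, one \<open>D\<close>
        comes from comparing averaging radii and two come from the volume of the section, where
        \<open>K \<le> k\<close>.\<close>
      have "(K * k) ^ D \<le> (k * k) ^ D" using K k by (intro power_mono mult_right_mono) (auto simp: k_def)
      hence "c * (V * (K * k) ^ D) \<le> c * (V * (k * k) ^ D)" using c V by (intro mult_left_mono) auto
      also have "\<dots> = C1 * V * (k ^ D * k ^ D * k ^ D * k powr \<bar>\<alpha>\<bar>) * exp (- q * \<theta> / 2)"
        by (simp add: c_def power_mult_distrib mult_ac)
      also have "k ^ D * k ^ D * k ^ D * k powr \<bar>\<alpha>\<bar> = k powr (3 * D + \<bar>\<alpha>\<bar>)"
        using k by (simp add: powr_realpow[symmetric] powr_add[symmetric])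
      finally show "c * (V * (K * k) ^ D) \<le> C1 * V * (1 + K) powr (3 * D + \<bar>\<alpha>\<bar>) * exp (- q * \<theta> / 2)"
        by (simp add: k_def)
    qed
    finally show ?thesis by (simp add: mult_right_mono)
  qed
  with C1 V show ?thesis unfolding D_def by (intro exI[of _ "C1 * V"]) auto
qed

text \<open>The constants \<open>C\<close> and \<open>a\<close> precede \<open>K\<close>, \<theta>
  and \<open>S\<close>: later the gain \<open>exp (- \<theta> / 2)\<close> must beat the power of
  \<open>1 + K\<close> while both parameters grow. For infinite \<open>p\<close> the centre
  \<open>y\<close> of the ball already suffices.\<close>

lemma S_norm_average:
  assumes p: "p > 0"
  shows "\<exists>C>0. \<exists>a. \<forall>K \<theta> S (f :: complex ^ 'n \<Rightarrow> complex) \<psi>.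
    slice_entire f \<longrightarrow> K \<ge> 0 \<longrightarrow> S \<in> sets borel \<longrightarrow> dominated K \<theta> S f \<psi> \<longrightarrow>
    S_norm p \<alpha> \<psi> \<le> ennreal (C * (1 + K) powr a * exp (- \<theta> / 2)) *
      S_norm p \<alpha> (\<lambda>z. if z \<in> S then f z else 0)"
proof (cases "p = \<infinity>")
  case True
  have "S_norm p \<alpha> \<psi> \<le> ennreal ((1 + K) powr \<bar>\<alpha>\<bar> * exp (- \<theta> / 2)) *
      S_norm p \<alpha> (\<lambda>z. if z \<in> S then f z else 0)"
    if K: "K \<ge> 0" and dom: "dominated K \<theta> S f \<psi>"
    for K \<theta> S and f \<psi> :: "complex ^ 'n \<Rightarrow> complex"
  proof -
    have S: "S_norm p \<alpha> \<psi> = (SUP z. ennreal (norm (\<psi> z) * exp (- (norm z)\<^sup>2 / 2) * (1 + norm z) powr (-\<alpha>)))"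
      for \<psi> :: "complex ^ 'n \<Rightarrow> complex"
      by (simp add: S_norm_def True powr_minus field_simps)
    have pos: "1 + norm z > 0" for z :: "complex ^ 'n" using norm_ge_zero[of z] by linarith
    have "ennreal (norm (\<psi> z) * exp (- (norm z)\<^sup>2 / 2) * (1 + norm z) powr (-\<alpha>))
      \<le> ennreal ((1 + K) powr \<bar>\<alpha>\<bar> * exp (- \<theta> / 2)) * S_norm p \<alpha> (\<lambda>z. if z \<in> S then f z else 0)" for z
    proof (cases "\<psi> z = 0")
      case False
      obtain y where y: "norm (\<psi> z) \<le> norm (f y)" "y \<in> S" "dist y z \<le> K / (1 + norm z)"
        "(norm y)\<^sup>2 \<le> (norm z)\<^sup>2 - \<theta>"
        using dom False pos[of z] unfolding dominated_def by (metis centre_in_ball zero_less_divide_1_iff)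
      note cmp = one_plus_norm_comparable[OF y(3) K]
      have w: "(1 + norm z) powr (-\<alpha>) \<le> (1 + K) powr \<bar>\<alpha>\<bar> * (1 + norm y) powr (-\<alpha>)"
        using powr_comparable[OF pos[of z] pos[of y] cmp(2) cmp(1), of "-\<alpha>"] K by simp
      have e: "exp (- (norm z)\<^sup>2 / 2) \<le> exp (- \<theta> / 2) * exp (- (norm y)\<^sup>2 / 2)"
        using y(4) by (simp add: exp_add[symmetric] field_simps)
      have "norm (\<psi> z) * exp (- (norm z)\<^sup>2 / 2) * (1 + norm z) powr (-\<alpha>)
          \<le> (norm (f y) * (exp (- \<theta> / 2) * exp (- (norm y)\<^sup>2 / 2))) * ((1 + K) powr \<bar>\<alpha>\<bar> * (1 + norm y) powr (-\<alpha>))"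
        by (intro mult_mono y(1) e w) auto
      also have "\<dots> = ((1 + K) powr \<bar>\<alpha>\<bar> * exp (- \<theta> / 2)) *
          (norm (if y \<in> S then f y else 0) * exp (- (norm y)\<^sup>2 / 2) * (1 + norm y) powr (-\<alpha>))"
        using y(2) by (simp add: mult_ac)
      finally have "ennreal (norm (\<psi> z) * exp (- (norm z)\<^sup>2 / 2) * (1 + norm z) powr (-\<alpha>)) \<le> ennreal \<dots>"
        by (rule ennreal_leI)
      also have "\<dots> = ennreal ((1 + K) powr \<bar>\<alpha>\<bar> * exp (- \<theta> / 2)) *
          ennreal (norm (if y \<in> S then f y else 0) * exp (- (norm y)\<^sup>2 / 2) * (1 + norm y) powr (-\<alpha>))"
        by (intro ennreal_mult) auto
      also have "\<dots> \<le> ennreal ((1 + K) powr \<bar>\<alpha>\<bar> * exp (- \<theta> / 2)) * S_norm p \<alpha> (\<lambda>z. if z \<in> S then f z else 0)"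
        unfolding S by (intro mult_left_mono SUP_upper UNIV_I) auto
      finally show ?thesis .
    qed simp
    thus ?thesis unfolding S[of \<psi>] by (intro SUP_least)
  qed
  thus ?thesis by (intro exI[of _ 1] conjI exI[of _ "\<bar>\<alpha>\<bar>"]) auto
next
  case False
  define q where "q = enn2real p"
  have q: "q > 0" using p False by (simp add: q_def enn2real_pos_finite)
  define b where "b = real (3 * DIM(complex ^ 'n)) + \<bar>\<alpha>\<bar>"
  obtain C where C: "C > 0" "\<And>K \<theta> S (f :: complex ^ 'n \<Rightarrow> complex) \<psi>.
    slice_entire f \<Longrightarrow> K \<ge> 0 \<Longrightarrow> S \<in> sets borel \<Longrightarrow> dominated K \<theta> S f \<psi> \<Longrightarrow>
    weighted_integral q \<alpha> \<psi> \<le> ennreal (C * (1 + K) powr b * exp (- q * \<theta> / 2)) *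
      weighted_integral q \<alpha> (\<lambda>z. if z \<in> S then f z else 0)"
    using weighted_integral_average[OF q, where \<alpha>=\<alpha> and 'n='n] unfolding b_def by blast
  have S: "S_norm p \<alpha> \<psi> = ennreal_rpow (weighted_integral q \<alpha> \<psi>) (1 / q)" for \<psi> :: "complex ^ 'n \<Rightarrow> complex"
    using False by (simp add: S_norm_def q_def)
  have "S_norm p \<alpha> \<psi> \<le> ennreal (C powr (1 / q) * (1 + K) powr (b / q) * exp (- \<theta> / 2)) *
      S_norm p \<alpha> (\<lambda>z. if z \<in> S then f z else 0)"
    if "slice_entire f" "K \<ge> 0" "S \<in> sets borel" "dominated K \<theta> S f \<psi>"
    for K \<theta> S and f \<psi> :: "complex ^ 'n \<Rightarrow> complex"
  proof -
    have "S_norm p \<alpha> \<psi> \<le> ennreal ((C * (1 + K) powr b * exp (- q * \<theta> / 2)) powr (1 / q)) *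
      S_norm p \<alpha> (\<lambda>z. if z \<in> S then f z else 0)"
      unfolding S using C q that
      by (subst ennreal_rpow_cmult[symmetric]) (auto intro!: ennreal_rpow_mono)
    also have "(C * (1 + K) powr b * exp (- q * \<theta> / 2)) powr (1 / q) = C powr (1 / q) * (1 + K) powr (b / q) * exp (- \<theta> / 2)"
      using q by (simp add: powr_mult powr_powr exp_powr_real)
    finally show ?thesis .
  qed
  moreover have "C powr (1 / q) > 0" using C by simp
  ultimately show ?thesis by blast
qed

text \<open>The averaging ball adds one unit, whence \<open>K + 1\<close>. The squared norm can grow
  by \<open>2 * norm z * r + r^2\<close> with \<open>r = (K + 1) / (1 + norm z)\<close>, which is
  bounded since \<open>norm z * r \<le> K + 1\<close>; this bounded loss is a negative
  \<theta>.\<close>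

lemma dominated_nearby:
  assumes K: "K \<ge> 0" and near: "\<And>z. \<exists>y. norm (\<psi> z) \<le> norm (f y) \<and> dist y z \<le> K / (1 + norm z)"
  shows "dominated (K + 1) (- (2 * (K + 1) + (K + 1)\<^sup>2)) UNIV f \<psi>"
  unfolding dominated_def
proof (intro allI disjI2)
  fix z
  obtain y where y: "norm (\<psi> z) \<le> norm (f y)" "dist y z \<le> K / (1 + norm z)"
    using near by blast
  have pos: "1 + norm z > 0" using norm_ge_zero[of z] by linarith
  have "dist w z \<le> (K + 1) / (1 + norm z) \<and> (norm w)\<^sup>2 \<le> (norm z)\<^sup>2 + (2 * (K + 1) + (K + 1)\<^sup>2)"
    if "w \<in> ball y (1 / (1 + norm z))" for w
  proof
    show d: "dist w z \<le> (K + 1) / (1 + norm z)"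
      using that y(2) dist_triangle[of w z y] by (simp add: add_divide_distrib dist_commute)
    let ?r = "(K + 1) / (1 + norm z)"
    have "norm w \<le> norm z + ?r" using d norm_triangle_sub[of w z] by (simp add: dist_norm)
    hence "(norm w)\<^sup>2 \<le> (norm z + ?r)\<^sup>2" by (intro power_mono) auto
    also have "\<dots> = (norm z)\<^sup>2 + (2 * (norm z * ?r) + ?r\<^sup>2)" by (simp add: power2_sum)
    also have "\<dots> \<le> (norm z)\<^sup>2 + (2 * (K + 1) + (K + 1)\<^sup>2)"
    proof (intro add_mono mult_left_mono power_mono order_refl)
      have "0 \<le> K * norm z" using K by simp
      thus "norm z * ?r \<le> K + 1" "?r \<le> K + 1"
        using K pos by (auto simp: pos_divide_le_eq algebra_simps)
    qed (use K pos in auto)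
    finally show "(norm w)\<^sup>2 \<le> (norm z)\<^sup>2 + (2 * (K + 1) + (K + 1)\<^sup>2)" .
  qed
  thus "\<exists>y. norm (\<psi> z) \<le> norm (f y) \<and> (\<forall>w\<in>ball y (1 / (1 + norm z)).
      w \<in> UNIV \<and> dist w z \<le> (K + 1) / (1 + norm z) \<and> (norm w)\<^sup>2 \<le> (norm z)\<^sup>2 - - (2 * (K + 1) + (K + 1)\<^sup>2))"
    by (intro exI[of _ y] conjI ballI y(1) UNIV_I) (simp_all only: diff_minus_eq_add)
qed

lemma S_norm_nearby:
  assumes p: "p > 0" and K: "K \<ge> 0"
  shows "\<exists>C>0. \<forall>(f :: complex ^ 'n \<Rightarrow> complex) \<psi>. slice_entire f \<longrightarrow>
    (\<forall>z. \<exists>y. norm (\<psi> z) \<le> norm (f y) \<and> dist y z \<le> K / (1 + norm z)) \<longrightarrow>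
    S_norm p \<alpha> \<psi> \<le> ennreal C * S_norm p \<alpha> f"
proof -
  obtain C a where C: "C > 0" "\<And>K \<theta> S (f :: complex ^ 'n \<Rightarrow> complex) \<psi>.
    slice_entire f \<Longrightarrow> K \<ge> 0 \<Longrightarrow> S \<in> sets borel \<Longrightarrow> dominated K \<theta> S f \<psi> \<Longrightarrow>
    S_norm p \<alpha> \<psi> \<le> ennreal (C * (1 + K) powr a * exp (- \<theta> / 2)) *
      S_norm p \<alpha> (\<lambda>z. if z \<in> S then f z else 0)"
    using S_norm_average[OF p, where \<alpha>=\<alpha> and 'n='n] by blast
  let ?\<theta> = "- (2 * (K + 1) + (K + 1)\<^sup>2)"
  show ?thesis
  proof (intro exI[of _ "C * (1 + (K + 1)) powr a * exp (- ?\<theta> / 2)"] conjI allI impI)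
    fix f \<psi> :: "complex ^ 'n \<Rightarrow> complex"
    assume "slice_entire f" "\<forall>z. \<exists>y. norm (\<psi> z) \<le> norm (f y) \<and> dist y z \<le> K / (1 + norm z)"
    thus "S_norm p \<alpha> \<psi> \<le> ennreal (C * (1 + (K + 1)) powr a * exp (- ?\<theta> / 2)) * S_norm p \<alpha> f"
      using C(2)[of f "K + 1" UNIV ?\<theta> \<psi>] dominated_nearby[OF K, of \<psi> f] K by simp
  qed (use C K in simp)
qed

section \<open>Values along rays, and truncation to balls\<close>

lemma radial_increment:
  assumes f: "slice_entire f" and c: "c \<ge> 1" and t: "0 \<le> t" "t \<le> 1"
    and B: "\<And>\<tau>. t \<le> \<tau> \<Longrightarrow> \<tau> \<le> 1 \<Longrightarrow> norm (euler c f (\<tau> *\<^sub>R z)) \<le> B"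
  shows "norm (f z - of_real (t ^ c) * f (t *\<^sub>R z)) \<le> (1 - t) * B"
proof -
  \<comment> \<open>With \<open>c \<ge> 1\<close> the factor \<open>w ^ (c - 1)\<close> in the
    derivative is a genuine power, at most 1 on the segment even if it starts at 0.\<close>
  obtain c' where c': "c = Suc c'" using c by (cases c) auto
  define g where "g w = w ^ c * f (w *s z)" for w
  define g' where "g' w = w ^ c' * euler c f (w *s z)" for w
  have der: "(g has_field_derivative g' w) (at w within T)" for w T
  proof -
    have "(g has_field_derivative (of_nat c * w ^ c' * f (w *s z) + w ^ c * (\<Sum>j\<in>UNIV. z $ j * partial_deriv j f (w *s z)))) (at w)"
    proof -
      have "((\<lambda>w. w ^ c) has_field_derivative of_nat c * w ^ c') (at w)"
        by (rule derivative_eq_intros refl)+ (simp add: c')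
      from DERIV_mult[OF this slice_entire_deriv0[OF f, of z w]]
      show ?thesis unfolding g_def by (simp add: mult.commute add.commute)
    qed
    moreover have "of_nat c * w ^ c' * f (w *s z) + w ^ c * (\<Sum>j\<in>UNIV. z $ j * partial_deriv j f (w *s z)) = g' w"
      unfolding g'_def euler_def by (simp add: c' algebra_simps sum_distrib_left)
    ultimately show ?thesis by (simp add: has_field_derivative_at_within)
  qed
  have bd: "norm (g' w) \<le> B" if "w \<in> closed_segment (of_real t) 1" for w
  proof -
    have "w \<in> closed_segment (of_real t) (of_real 1)" using that by simp
    then obtain \<tau> where \<tau>: "\<tau> \<in> closed_segment t 1" "w = of_real \<tau>"
      unfolding closed_segment_of_real by blast
    hence r: "t \<le> \<tau>" "\<tau> \<le> 1" "0 \<le> \<tau>" using t by (auto simp: closed_segment_eq_real_ivl)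
    have "norm (g' w) = \<tau> ^ c' * norm (euler c f (\<tau> *\<^sub>R z))"
      using r by (simp add: g'_def \<tau> of_real_vector_scalar_mult norm_mult norm_power)
    also have "\<dots> \<le> 1 * B" using r by (intro mult_mono B power_le_one) auto
    finally show ?thesis by simp
  qed
  have "norm (g 1 - g (of_real t)) \<le> B * norm (1 - of_real t :: complex)"
    by (rule field_differentiable_bound[where S="closed_segment (of_real t) 1" and f'=g'])
      (auto intro: der bd)
  moreover have "norm (1 - of_real t :: complex) = 1 - t"
    using t by (metis abs_of_nonneg diff_ge_0_iff_ge norm_of_real of_real_1 of_real_diff)
  ultimately show ?thesis by (simp add: g_def of_real_vector_scalar_mult mult.commute)
qed

definition cutoff :: "real \<Rightarrow> (complex ^ 'n \<Rightarrow> complex) \<Rightarrow> complex ^ 'n \<Rightarrow> complex" where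
  "cutoff R f z = (if z \<in> cball 0 R then f z else 0)"

lemma borel_measurable_slice_entire: "slice_entire f \<Longrightarrow> f \<in> borel_measurable borel"
  using slice_entire_continuous borel_measurable_continuous_onI by blast

lemma S_norm_cutoff_finite:
  fixes f :: "complex ^ 'n \<Rightarrow> complex"
  assumes p: "p > 0" and f: "slice_entire f"
  shows "S_norm p \<alpha> (cutoff R f) < \<infinity>"
proof -
  define h where "h z = norm (f z) * exp (- (norm z)\<^sup>2 / 2)" for z :: "complex ^ 'n"
  have pos: "1 + norm z > 0" for z :: "complex ^ 'n" using norm_ge_zero[of z] by linarith
  hence ne: "1 + norm z \<noteq> 0" for z :: "complex ^ 'n" by (metis less_irrefl)
  have bdd: "\<exists>M\<ge>0. \<forall>z\<in>cball 0 R. g z \<le> M" if "continuous_on UNIV g" for g :: "complex ^ 'n \<Rightarrow> real"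
  proof -
    have "compact (g ` cball 0 R)"
      by (intro compact_continuous_image compact_cball continuous_on_subset[OF that]) auto
    then obtain M where "M > 0" "\<forall>x\<in>g ` cball 0 R. norm x \<le> M"
      by (meson bounded_pos compact_imp_bounded)
    thus ?thesis by (intro exI[of _ M]) force
  qed
  have ch: "continuous_on UNIV h"
    unfolding h_def by (intro continuous_intros slice_entire_continuous f) auto
  show ?thesis
  proof (cases "p = \<infinity>")
    case True
    have "continuous_on UNIV (\<lambda>z. h z / (1 + norm z) powr \<alpha>)"
      using ne by (intro continuous_intros ch) auto
    from bdd[OF this] obtain M where M: "M \<ge> 0" "\<And>z. z \<in> cball 0 R \<Longrightarrow> h z / (1 + norm z) powr \<alpha> \<le> M"
      by blast
    have "S_norm p \<alpha> (cutoff R f) \<le> ennreal M"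
      unfolding S_norm_def using True M by (auto simp: cutoff_def h_def intro!: SUP_least ennreal_leI)
    thus ?thesis by (simp add: le_less_trans)
  next
    case False
    define q where "q = enn2real p"
    have q: "q > 0" using p False by (simp add: q_def enn2real_pos_finite)
    have "continuous_on UNIV (\<lambda>z. h z powr q * (1 + norm z) powr (-\<alpha>))"
      using ne q by (intro continuous_intros continuous_on_powr' ch) (auto simp: h_def)
    from bdd[OF this] obtain M where M: "M \<ge> 0" "\<And>z. z \<in> cball 0 R \<Longrightarrow> h z powr q * (1 + norm z) powr (-\<alpha>) \<le> M"
      by blast
    have [measurable]: "cball (0 :: complex ^ 'n) R \<in> sets borel" by simp
    have "weighted_integral q \<alpha> (cutoff R f) \<le> (\<integral>\<^sup>+z. ennreal M * indicator (cball 0 R) (z :: complex ^ 'n) \<partial>dV)"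
      unfolding weighted_integral_def using M q
      by (intro nn_integral_mono) (auto simp: cutoff_def h_def indicator_def intro!: ennreal_leI)
    also have "\<dots> = ennreal (1 / pi ^ CARD('n)) * (\<integral>\<^sup>+z. ennreal M * indicator (cball 0 R) (z :: complex ^ 'n) \<partial>lborel)"
      by (rule nn_integral_dV) measurable
    also have "\<dots> < \<infinity>"
      using emeasure_bounded_finite[OF bounded_cball, of "0 :: complex ^ 'n" R]
      by (simp add: nn_integral_cmult_indicator ennreal_mult_less_top)
    finally show ?thesis using False
      by (simp add: S_norm_def q_def[symmetric] ennreal_rpow_def)
  qed
qed

text \<open>Monotone convergence along integer radii for finite \<open>p\<close>; for infinite
  \<open>p\<close> the truncation at radius \<open>norm z\<close> already sees the value at
  \<open>z\<close>.\<close>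

lemma S_norm_le_if_cutoff:
  fixes f :: "complex ^ 'n \<Rightarrow> complex"
  assumes p: "p > 0" and f: "slice_entire f" and le: "\<And>R. S_norm p \<alpha> (cutoff R f) \<le> B"
  shows "S_norm p \<alpha> f \<le> B"
proof (cases "p = \<infinity>")
  case True
  let ?W = "\<lambda>\<psi> z. ennreal (norm (\<psi> z) * exp (- (norm z)\<^sup>2 / 2) / (1 + norm z) powr \<alpha>)"
  have S: "S_norm p \<alpha> \<psi> = (SUP z. ?W \<psi> z)" for \<psi> :: "complex ^ 'n \<Rightarrow> complex"
    by (simp add: S_norm_def True)
  have "?W f z \<le> B" for z
  proof -
    have "?W f z = ?W (cutoff (norm z) f) z" by (simp add: cutoff_def)
    also have "\<dots> \<le> S_norm p \<alpha> (cutoff (norm z) f)"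
      unfolding S by (rule SUP_upper) simp
    finally show ?thesis using le by (rule order_trans)
  qed
  thus ?thesis unfolding S by (intro SUP_least)
next
  case False
  define q where "q = enn2real p"
  have q: "q > 0" using p False by (simp add: q_def enn2real_pos_finite)
  have S: "S_norm p \<alpha> \<psi> = ennreal_rpow (weighted_integral q \<alpha> \<psi>) (1 / q)" for \<psi> :: "complex ^ 'n \<Rightarrow> complex"
    using False by (simp add: S_norm_def q_def)
  show ?thesis
  proof (cases B)
    case (real b)
    have "weighted_integral q \<alpha> (cutoff R f) \<le> ennreal (b powr q)" for R
    proof (cases "weighted_integral q \<alpha> (cutoff R f)")
      case (real x)
      have "x powr (1 / q) \<le> b"
        using le[of R] real \<open>B = ennreal b\<close> \<open>0 \<le> b\<close> unfolding S by (simp add: ennreal_rpow_def)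
      hence "(x powr (1 / q)) powr q \<le> b powr q" using q by (intro powr_mono2) auto
      thus ?thesis using real q by (simp add: powr_powr ennreal_leI)
    next
      case top
      thus ?thesis using le[of R] real unfolding S by (simp add: ennreal_rpow_def top_unique)
    qed
    note cutoff_le = this
    let ?h = "\<lambda>R z. ennreal ((norm (cutoff (real R) f z) * exp (- (norm z)\<^sup>2 / 2)) powr q * (1 + norm z) powr (- \<alpha>))"
    have "weighted_integral q \<alpha> f = (\<integral>\<^sup>+z. (SUP R. ?h R z) \<partial>dV)"
      unfolding weighted_integral_def
    proof (intro nn_integral_cong antisym)
      fix z :: "complex ^ 'n"
      obtain R :: nat where "norm z \<le> real R" using real_arch_simple by blast
      hence "ennreal ((norm (f z) * exp (- (norm z)\<^sup>2 / 2)) powr q * (1 + norm z) powr (- \<alpha>)) = ?h R z"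
        by (simp add: cutoff_def)
      also have "?h R z \<le> (SUP R. ?h R z)" by (rule SUP_upper) simp
      finally show "ennreal ((norm (f z) * exp (- (norm z)\<^sup>2 / 2)) powr q * (1 + norm z) powr (- \<alpha>)) \<le> (SUP R. ?h R z)"
        .
      show "(SUP R. ?h R z) \<le> ennreal ((norm (f z) * exp (- (norm z)\<^sup>2 / 2)) powr q * (1 + norm z) powr (- \<alpha>))"
        by (intro SUP_least) (use q in \<open>auto simp: cutoff_def\<close>)
    qed
    also have "\<dots> = (SUP R. \<integral>\<^sup>+z. ?h R z \<partial>dV)"
    proof (rule nn_integral_monotone_convergence_SUP)
      show "incseq ?h"
        using q by (auto simp: incseq_def le_fun_def cutoff_def)
      show "?h R \<in> borel_measurable dV" for R
      proof (rule borel_measurable_dV)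
        note [measurable] = borel_measurable_slice_entire[OF f]
        show "?h R \<in> borel_measurable borel" unfolding cutoff_def mem_cball_0 by measurable
      qed
    qed
    also have "\<dots> \<le> ennreal (b powr q)"
      using cutoff_le unfolding weighted_integral_def by (intro SUP_least)
    finally have "S_norm p \<alpha> f \<le> ennreal_rpow (ennreal (b powr q)) (1 / q)"
      unfolding S using q by (intro ennreal_rpow_mono) auto
    thus ?thesis using real q by (simp add: ennreal_rpow_def powr_powr)
  qed simp
qed

section \<open>Radial Hardy inequality by absorption\<close>

text \<open>The formula is the averaging constant for \<open>K = \<kappa> + 1\<close> and gain
  \<open>(\<kappa> - 2) / 4\<close>, so that \<open>1 + K = 2 + \<kappa>\<close>. The target
  \<open>1 / 2\<close> is the coefficient to be absorbed, and \<open>\<kappa> \<ge> 4\<close> serves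
  the geometry of the contraction.\<close>

lemma exists_decay:
  fixes Q a :: real
  shows "\<exists>\<kappa>\<ge>4. Q * (2 + \<kappa>) powr a * exp (- (\<kappa> - 2) / 8) \<le> 1 / 2"
proof -
  have "((\<lambda>\<kappa>. Q * (2 + \<kappa>) powr a * exp (- (\<kappa> - 2) / 8)) \<longlongrightarrow> 0) at_top"
    by real_asymp
  hence "\<forall>\<^sub>F \<kappa> in at_top. Q * (2 + \<kappa>) powr a * exp (- (\<kappa> - 2) / 8) < 1 / 2"
    by (rule order_tendstoD) simp
  hence "\<forall>\<^sub>F \<kappa> in at_top. \<kappa> \<ge> 4 \<and> Q * (2 + \<kappa>) powr a * exp (- (\<kappa> - 2) / 8) \<le> 1 / 2"
    using eventually_ge_at_top[of 4] by eventually_elim auto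
  thus ?thesis using eventually_happens' trivial_limit_at_top_linorder by blast
qed

text \<open>Subtraction is legitimate only for finite \<open>X\<close>: an infinite \<open>X\<close>
  satisfies the inequality for every \<open>Y\<close>. This is what forces the truncation.\<close>

lemma ennreal_absorb:
  fixes X Y :: ennreal
  assumes "X \<le> ennreal (1 / 2) * X + Y" "X < \<infinity>"
  shows "X \<le> ennreal 2 * Y"
proof (cases Y)
  case (real y)
  obtain x where x: "X = ennreal x" "x \<ge> 0" using assms(2) by (cases X) auto
  have "ennreal x \<le> ennreal (1 / 2 * x + y)"
    using assms(1) x real by (simp only: ennreal_mult[symmetric] ennreal_plus[symmetric] mult_nonneg_nonneg)
  hence "x \<le> 1 / 2 * x + y" using x real by (subst (asm) ennreal_le_iff) auto
  hence "x \<le> 2 * y" by simp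
  hence "ennreal x \<le> ennreal (2 * y)" by (rule ennreal_leI)
  also have "\<dots> = ennreal 2 * ennreal y" using real by (intro ennreal_mult) auto
  finally show ?thesis using x real by simp
qed (simp add: ennreal_mult_top)

text \<open>
  Moving inwards by about \<open>\<kappa> / (1 + |z|)\<close> lowers \<open>|z|\<^sup>2\<close> by at least \<open>(\<kappa> - 2) / 4\<close>, so the
  Gaussian weight gains an exponential factor in \<open>\<kappa>\<close>. This beats the polynomial loss in
  \<open>\<kappa>\<close> of the averaging estimate.
\<close>

definition contraction :: "real \<Rightarrow> complex ^ 'n \<Rightarrow> real" where
  "contraction \<kappa> z = max 0 (1 - \<kappa> / (1 + norm z)\<^sup>2)"

lemma dominated_contraction:
  fixes f :: "complex ^ 'n \<Rightarrow> complex"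
  assumes \<kappa>: "\<kappa> \<ge> 4"
  shows "dominated (\<kappa> + 1) ((\<kappa> - 2) / 4) (cball 0 R) f
    (\<lambda>z. if norm z \<le> R \<and> \<kappa> < (1 + norm z)\<^sup>2 then f (contraction \<kappa> z *\<^sub>R z) else 0)"
  unfolding dominated_def
proof (intro allI)
  fix z :: "complex ^ 'n"
  let ?\<psi> = "\<lambda>z. if norm z \<le> R \<and> \<kappa> < (1 + norm z)\<^sup>2 then f (contraction \<kappa> z *\<^sub>R z) else 0"
  show "?\<psi> z = 0 \<or> (\<exists>y. norm (?\<psi> z) \<le> norm (f y) \<and> (\<forall>w\<in>ball y (1 / (1 + norm z)).
      w \<in> cball 0 R \<and> dist w z \<le> (\<kappa> + 1) / (1 + norm z) \<and> (norm w)\<^sup>2 \<le> (norm z)\<^sup>2 - (\<kappa> - 2) / 4))"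
  proof (cases "norm z \<le> R \<and> \<kappa> < (1 + norm z)\<^sup>2")
    case True
    define t where "t = contraction \<kappa> z"
    define d where "d = 1 / (1 + norm z)"
    have pos: "1 + norm z > 0" using norm_ge_zero[of z] by linarith
    hence d: "d > 0" "d * (1 + norm z) = 1" by (auto simp: d_def)
    have "2\<^sup>2 < (1 + norm z)\<^sup>2" using True \<kappa> by simp
    hence "2 < 1 + norm z" by (rule power2_less_imp_less) (use pos in simp)
    hence z1: "norm z > 1" by simp
    have tq: "t = 1 - \<kappa> * d\<^sup>2"
      using True pos by (simp add: t_def contraction_def d_def power_divide)
    have t: "0 \<le> t" "t \<le> 1" using tq \<kappa> by (auto simp: t_def contraction_def)
    \<comment> \<open>The lower bound needs \<open>norm z > 1\<close>, which follows from
      \<open>\<kappa> \<ge> 4\<close> where the contraction does not collapse to 0.\<close>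
    have dz: "d * norm z \<le> 1" "d * norm z \<ge> 1 / 2"
      using z1 pos by (auto simp: d_def field_simps)
    have "w \<in> cball 0 R \<and> dist w z \<le> (\<kappa> + 1) * d \<and> (norm w)\<^sup>2 \<le> (norm z)\<^sup>2 - (\<kappa> - 2) / 4"
      if "w \<in> ball (t *\<^sub>R z) d" for w
    proof -
      have wt: "dist w (t *\<^sub>R z) < d" using that by (simp add: dist_commute)
      have "dist (t *\<^sub>R z) z = norm ((t - 1) *\<^sub>R z)" by (simp add: dist_norm scaleR_diff_left)
      also have "\<dots> = \<kappa> * d * (d * norm z)" using t \<kappa> d by (simp add: tq power2_eq_square)
      also have "\<dots> \<le> \<kappa> * d * 1" using \<kappa> d dz by (intro mult_left_mono) auto
      finally have 1: "dist w z \<le> (\<kappa> + 1) * d"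
        using wt dist_triangle[of w z "t *\<^sub>R z"] by (simp add: algebra_simps)
      have "norm w \<le> norm (t *\<^sub>R z) + d"
        using wt norm_triangle_sub[of w "t *\<^sub>R z"] by (simp add: dist_norm)
      also have "norm (t *\<^sub>R z) = t * norm z" using t by simp
      also have "t * norm z + d = norm z - \<kappa> * d * (d * norm z) + d" by (simp add: tq power2_eq_square algebra_simps)
      also have "\<dots> \<le> norm z - \<kappa> * d * (1 / 2) + d" using \<kappa> d dz by (intro add_mono diff_mono mult_left_mono) auto
      also have "\<dots> = norm z - (\<kappa> / 2 - 1) * d" by (simp add: algebra_simps)
      \<comment> \<open>Net inward move: at least \<open>\<kappa> * d / 2\<close> by the
        contraction, less the radius \<open>d\<close> of the averaging ball.\<close>
      finally have w: "norm w \<le> norm z - (\<kappa> / 2 - 1) * d" .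
      have g: "(\<kappa> / 2 - 1) * d \<ge> 0" using \<kappa> d by simp
      have "(\<kappa> - 2) / 4 = (\<kappa> / 2 - 1) * (1 / 2)" by (simp add: field_simps)
      also have "\<dots> \<le> (\<kappa> / 2 - 1) * (d * norm z)" using \<kappa> dz by (intro mult_left_mono) auto
      also have "\<dots> = ((\<kappa> / 2 - 1) * d) * norm z" by simp
      also have "\<dots> \<le> (norm z - norm w) * (norm z + norm w)"
        using w g by (intro mult_mono) auto
      also have "\<dots> = (norm z)\<^sup>2 - (norm w)\<^sup>2" by (simp add: algebra_simps power2_eq_square)
      finally have 2: "(norm w)\<^sup>2 \<le> (norm z)\<^sup>2 - (\<kappa> - 2) / 4" by linarith
      \<comment> \<open>This closes the absorption: averaging the contracted values of the truncated
        \<open>f\<close> involves \<open>f\<close> only on the same ball.\<close>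
      have "w \<in> cball 0 R" using w g True by simp
      with 1 2 show ?thesis by blast
    qed
    thus ?thesis using True unfolding t_def d_def by (intro disjI2 exI[of _ "contraction \<kappa> z *\<^sub>R z"]) auto
  qed auto
qed

lemma continuous_attains_max_segment:
  fixes g :: "complex ^ 'n \<Rightarrow> complex"
  assumes g: "continuous_on UNIV g" and t: "t \<le> 1"
  obtains \<tau> where "t \<le> \<tau>" "\<tau> \<le> 1" "\<And>\<sigma>. t \<le> \<sigma> \<Longrightarrow> \<sigma> \<le> 1 \<Longrightarrow> norm (g (\<sigma> *\<^sub>R z)) \<le> norm (g (\<tau> *\<^sub>R z))"
proof -
  have "continuous_on {t..1} (\<lambda>\<sigma>. norm (g (\<sigma> *\<^sub>R z)))"
    by (intro continuous_intros continuous_on_compose2[OF g]) auto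
  thus ?thesis
    using continuous_attains_sup[of "{t..1}" "\<lambda>\<sigma>. norm (g (\<sigma> *\<^sub>R z))"] t that by auto
qed

text \<open>The maximum of \<open>euler c f\<close> over the radial segment is attained, so the
  bound along the segment becomes a value at a single nearby point, the form that
  \<open>S_norm_nearby\<close> accepts.\<close>

lemma radial_difference_nearby:
  fixes f :: "complex ^ 'n \<Rightarrow> complex"
  assumes f: "slice_entire f" and c: "c \<ge> 1" and \<kappa>: "\<kappa> \<ge> 4"
  shows "\<exists>y. norm (f z) - norm (if \<kappa> < (1 + norm z)\<^sup>2 then f (contraction \<kappa> z *\<^sub>R z) else 0)
      \<le> \<kappa> / (1 + norm z)\<^sup>2 * norm (euler c f y) \<and> dist y z \<le> \<kappa> / (1 + norm z)"
proof -
  define t where "t = contraction \<kappa> z"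
  define d where "d = 1 / (1 + norm z)"
  have pos: "1 + norm z > 0" using norm_ge_zero[of z] by linarith
  have d: "d > 0" "d * norm z \<le> 1" "d * (1 + norm z) = 1" using pos by (auto simp: d_def field_simps)
  have tq: "t = max 0 (1 - \<kappa> * d\<^sup>2)" by (simp add: t_def contraction_def d_def power_divide)
  have t: "0 \<le> t" "t \<le> 1" "1 - t \<le> \<kappa> * d\<^sup>2" using \<kappa> by (auto simp: tq)
  obtain \<tau> where \<tau>: "t \<le> \<tau>" "\<tau> \<le> 1" "\<And>\<sigma>. t \<le> \<sigma> \<Longrightarrow> \<sigma> \<le> 1 \<Longrightarrow> norm (euler c f (\<sigma> *\<^sub>R z)) \<le> norm (euler c f (\<tau> *\<^sub>R z))"
    using continuous_attains_max_segment[OF slice_entire_continuous[OF slice_entire_euler[OF f]] t(2)] by metis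
  have "norm (f z - of_real (t ^ c) * f (t *\<^sub>R z)) \<le> (1 - t) * norm (euler c f (\<tau> *\<^sub>R z))"
    by (rule radial_increment[OF f c t(1,2) \<tau>(3)])
  also have "\<dots> \<le> \<kappa> * d\<^sup>2 * norm (euler c f (\<tau> *\<^sub>R z))" using t by (intro mult_right_mono) auto
  finally have 1: "norm (f z - of_real (t ^ c) * f (t *\<^sub>R z)) \<le> \<dots>" .
  have "norm (of_real (t ^ c) * f (t *\<^sub>R z)) \<le> norm (if \<kappa> < (1 + norm z)\<^sup>2 then f (t *\<^sub>R z) else 0)"
  proof (cases "\<kappa> < (1 + norm z)\<^sup>2")
    case True
    have "t ^ c \<le> 1" using t by (intro power_le_one) auto
    thus ?thesis using True t mult_right_mono[of "t ^ c" 1 "norm (f (t *\<^sub>R z))"]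
      by (simp add: norm_mult norm_power)
  next
    case False
    hence "\<kappa> * d\<^sup>2 \<ge> 1" using pos by (simp add: d_def power_divide)
    \<comment> \<open>Near the origin the segment reaches 0, and \<open>t ^ c = 0\<close> removes
      the inner value, because \<open>c \<ge> 1\<close>.\<close>
    hence "t = 0" by (simp add: tq)
    thus ?thesis using c by (simp add: power_0_left)
  qed
  hence 2: "norm (f z) - norm (if \<kappa> < (1 + norm z)\<^sup>2 then f (t *\<^sub>R z) else 0) \<le> \<kappa> * d\<^sup>2 * norm (euler c f (\<tau> *\<^sub>R z))"
    using 1 norm_triangle_ineq2[of "f z" "of_real (t ^ c) * f (t *\<^sub>R z)"] by linarith
  have "dist (\<tau> *\<^sub>R z) z = norm ((\<tau> - 1) *\<^sub>R z)" by (simp add: dist_norm scaleR_diff_left)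
  also have "\<dots> = (1 - \<tau>) * norm z" using \<tau> by simp
  also have "\<dots> \<le> (\<kappa> * d\<^sup>2) * norm z" using \<tau> t by (intro mult_right_mono) auto
  also have "\<dots> = \<kappa> * d * (d * norm z)" by (simp add: power2_eq_square)
  also have "\<dots> \<le> \<kappa> * d * 1" using d \<kappa> by (intro mult_left_mono) auto
  finally have "dist (\<tau> *\<^sub>R z) z \<le> \<kappa> * d" by simp
  with 2 show ?thesis unfolding t_def d_def by (intro exI[of _ "\<tau> *\<^sub>R z"]) (simp add: power_divide)
qed

text \<open>The order of choices matters: \<open>C0\<close> and \<open>a\<close> do not depend on
  \<kappa>, so \<kappa> can be taken large enough to bring the coefficient of the truncated norm
  down to one half; \<open>C1\<close> depends on \<kappa>, but multiplies only the right-hand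
  side.\<close>

lemma S_norm_euler_ge:
  assumes p: "p > 0" and c: "c \<ge> 1"
  shows "\<exists>C>0. \<forall>f :: complex ^ 'n \<Rightarrow> complex. slice_entire f \<longrightarrow>
    S_norm p (\<alpha> - weight_shift p 2) f \<le> ennreal C * S_norm p \<alpha> (euler c f)"
proof -
  let ?\<beta> = "\<alpha> - weight_shift p 2"
  define Q where "Q = quasi_const p 2"
  have Q: "Q > 0" by (simp add: Q_def quasi_const_pos)
  obtain C0 a where C0: "C0 > 0" "\<And>K \<theta> S (f :: complex ^ 'n \<Rightarrow> complex) \<psi>.
    slice_entire f \<Longrightarrow> K \<ge> 0 \<Longrightarrow> S \<in> sets borel \<Longrightarrow> dominated K \<theta> S f \<psi> \<Longrightarrow>
    S_norm p ?\<beta> \<psi> \<le> ennreal (C0 * (1 + K) powr a * exp (- \<theta> / 2)) *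
      S_norm p ?\<beta> (\<lambda>z. if z \<in> S then f z else 0)"
    using S_norm_average[OF p, where \<alpha> = ?\<beta> and 'n='n] by blast
  obtain \<kappa> where \<kappa>: "\<kappa> \<ge> 4" "Q * C0 * (2 + \<kappa>) powr a * exp (- (\<kappa> - 2) / 8) \<le> 1 / 2"
    using exists_decay[of "Q * C0" a] by blast
  obtain C1 where C1: "C1 > 0" "\<And>(f :: complex ^ 'n \<Rightarrow> complex) \<psi>. slice_entire f \<Longrightarrow>
    \<forall>z. \<exists>y. norm (\<psi> z) \<le> norm (f y) \<and> dist y z \<le> \<kappa> / (1 + norm z) \<Longrightarrow>
    S_norm p \<alpha> \<psi> \<le> ennreal C1 * S_norm p \<alpha> f"
  proof -
    have "\<kappa> \<ge> 0" using \<kappa> by simp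
    from S_norm_nearby[OF p this, of \<alpha>, where 'n='n] show ?thesis using that by blast
  qed
  have "S_norm p ?\<beta> f \<le> ennreal (2 * (Q * (\<kappa> * C1))) * S_norm p \<alpha> (euler c f)"
    if f: "slice_entire f" for f :: "complex ^ 'n \<Rightarrow> complex"
  proof (rule S_norm_le_if_cutoff[OF p f])
    fix R
    note G = slice_entire_euler[OF f, of c]
    have pos: "1 + norm z > 0" for z :: "complex ^ 'n" using norm_ge_zero[of z] by linarith
    define \<psi>1 where "\<psi>1 z = (if norm z \<le> R \<and> \<kappa> < (1 + norm z)\<^sup>2 then f (contraction \<kappa> z *\<^sub>R z) else 0)" for z
    \<comment> \<open>The nonnegative excess of the modulus of \<open>f\<close> over its contracted
      value: clipping at 0 still gives \<open>norm f \<le> norm \<psi>1 + norm \<psi>2\<close> on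
      the ball.\<close>
    define \<psi>2 where "\<psi>2 z = (if norm z \<le> R then complex_of_real (max 0 (norm (f z) - norm (\<psi>1 z))) else 0)" for z
    note [measurable] = borel_measurable_slice_entire[OF f]
    have m1 [measurable]: "\<psi>1 \<in> borel_measurable borel"
      unfolding \<psi>1_def contraction_def by measurable
    have m2 [measurable]: "\<psi>2 \<in> borel_measurable borel"
      unfolding \<psi>2_def by measurable
    have "S_norm p ?\<beta> (cutoff R f) \<le> ennreal (1 * quasi_const p (card {False, True}))
        * (\<Sum>b\<in>{False, True}. S_norm p ?\<beta> (if b then \<psi>1 else \<psi>2))"
      by (rule S_norm_sum_le[OF p]) (auto simp: m1 m2 cutoff_def \<psi>2_def)
    hence split: "S_norm p ?\<beta> (cutoff R f) \<le> ennreal Q * (S_norm p ?\<beta> \<psi>1 + S_norm p ?\<beta> \<psi>2)"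
      by (simp add: Q_def numeral_2_eq_2 add.commute)
    have 1: "S_norm p ?\<beta> \<psi>1 \<le> ennreal (C0 * (2 + \<kappa>) powr a * exp (- (\<kappa> - 2) / 8)) * S_norm p ?\<beta> (cutoff R f)"
    proof -
      have e: "- ((\<kappa> - 2) / 4) / 2 = - (\<kappa> - 2) / 8" "1 + (\<kappa> + 1) = 2 + \<kappa>"
        by (simp_all add: diff_divide_distrib)
      have "S_norm p ?\<beta> \<psi>1 \<le> ennreal (C0 * (1 + (\<kappa> + 1)) powr a * exp (- ((\<kappa> - 2) / 4) / 2)) *
          S_norm p ?\<beta> (\<lambda>z. if z \<in> cball 0 R then f z else 0)"
        unfolding \<psi>1_def by (rule C0(2)[OF f _ _ dominated_contraction[OF \<kappa>(1)]]) (use \<kappa> in simp_all)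
      thus ?thesis unfolding e cutoff_def[abs_def] .
    qed
    \<comment> \<open>Rescaled so that its modulus is at most that of \<open>euler c f\<close> at a
      nearby point; the factor \<open>(1 + norm z)^2\<close> is exactly the shift from
      \<open>?\<beta>\<close> to \<alpha>.\<close>
    define \<omega> where "\<omega> z = complex_of_real ((1 + norm z)\<^sup>2 / \<kappa>) * \<psi>2 z" for z
    have m\<omega>: "\<omega> \<in> borel_measurable borel" unfolding \<omega>_def by measurable
    have near: "\<exists>y. norm (\<omega> z) \<le> norm (euler c f y) \<and> dist y z \<le> \<kappa> / (1 + norm z)" for z
    proof (cases "norm z \<le> R \<and> norm (f z) > norm (\<psi>1 z)")
      case True
      hence eq: "\<psi>1 z = (if \<kappa> < (1 + norm z)\<^sup>2 then f (contraction \<kappa> z *\<^sub>R z) else 0)"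
        by (simp only: \<psi>1_def simp_thms)
      obtain y where y: "norm (f z) - norm (\<psi>1 z) \<le> \<kappa> / (1 + norm z)\<^sup>2 * norm (euler c f y)"
        "dist y z \<le> \<kappa> / (1 + norm z)"
        using radial_difference_nearby[OF f c \<kappa>(1), of z] unfolding eq by blast
      have "\<psi>2 z = of_real (norm (f z) - norm (\<psi>1 z))"
        using True by (simp only: \<psi>2_def max_absorb2 diff_ge_0_iff_ge less_imp_le if_True)
      hence "norm (\<omega> z) = \<bar>(1 + norm z)\<^sup>2 / \<kappa>\<bar> * \<bar>norm (f z) - norm (\<psi>1 z)\<bar>"
        by (simp only: \<omega>_def norm_mult norm_of_real)
      also have "\<dots> = (1 + norm z)\<^sup>2 / \<kappa> * (norm (f z) - norm (\<psi>1 z))"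
        using True \<kappa> by (simp only: abs_of_nonneg zero_le_divide_iff zero_le_power2 diff_ge_0_iff_ge less_imp_le) simp
      also have "\<dots> \<le> (1 + norm z)\<^sup>2 / \<kappa> * (\<kappa> / (1 + norm z)\<^sup>2 * norm (euler c f y))"
        using y(1) \<kappa> by (intro mult_left_mono) auto
      also have "\<dots> = norm (euler c f y)" using pos[of z] \<kappa> by simp
      finally show ?thesis using y(2) by blast
    next
      case False
      hence "\<psi>2 z = 0" by (auto simp: \<psi>2_def)
      thus ?thesis using \<kappa> pos[of z] by (intro exI[of _ z]) (simp add: \<omega>_def)
    qed
    have "S_norm p ?\<beta> \<psi>2 = S_norm p \<alpha> (\<lambda>z. of_real ((1 + norm z) powr 2) * \<psi>2 z)"
      by (rule S_norm_weight[symmetric])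
    also have "\<dots> \<le> ennreal \<kappa> * S_norm p \<alpha> \<omega>"
    proof (rule S_norm_mono[OF p _ m\<omega>])
      fix z show "norm (of_real ((1 + norm z) powr 2) * \<psi>2 z) \<le> \<kappa> * norm (\<omega> z)"
        using \<kappa> pos[of z] unfolding \<omega>_def norm_mult norm_of_real by simp
    qed (use \<kappa> in auto)
    also have "\<dots> \<le> ennreal \<kappa> * (ennreal C1 * S_norm p \<alpha> (euler c f))"
      by (intro mult_left_mono C1(2)[OF G] allI near) simp
    finally have 2: "S_norm p ?\<beta> \<psi>2 \<le> \<dots>" .
    have "S_norm p ?\<beta> (cutoff R f) \<le> ennreal Q * (ennreal (C0 * (2 + \<kappa>) powr a * exp (- (\<kappa> - 2) / 8)) * S_norm p ?\<beta> (cutoff R f)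
        + ennreal \<kappa> * (ennreal C1 * S_norm p \<alpha> (euler c f)))"
      using split by (rule order_trans) (intro mult_left_mono add_mono 1 2, simp)
    also have "\<dots> = ennreal (Q * C0 * (2 + \<kappa>) powr a * exp (- (\<kappa> - 2) / 8)) * S_norm p ?\<beta> (cutoff R f)
        + ennreal (Q * (\<kappa> * C1)) * S_norm p \<alpha> (euler c f)"
      using Q C0(1) C1(1) \<kappa>(1) by (simp add: ennreal_mult distrib_left mult.assoc)
    also have "\<dots> \<le> ennreal (1 / 2) * S_norm p ?\<beta> (cutoff R f) + ennreal (Q * (\<kappa> * C1)) * S_norm p \<alpha> (euler c f)"
      by (intro add_right_mono mult_right_mono ennreal_leI \<kappa>(2)) simp
    finally have "S_norm p ?\<beta> (cutoff R f) \<le> ennreal 2 * (ennreal (Q * (\<kappa> * C1)) * S_norm p \<alpha> (euler c f))"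
      by (rule ennreal_absorb) (rule S_norm_cutoff_finite[OF p f])
    also have "\<dots> = ennreal (2 * (Q * (\<kappa> * C1))) * S_norm p \<alpha> (euler c f)"
    proof -
      have "Q * (\<kappa> * C1) \<ge> 0" using Q C1(1) \<kappa>(1) by (intro mult_nonneg_nonneg) auto
      hence "ennreal (2 * (Q * (\<kappa> * C1))) = ennreal 2 * ennreal (Q * (\<kappa> * C1))"
        by (intro ennreal_mult) auto
      thus ?thesis by (simp only: mult.assoc)
    qed
    finally show "S_norm p ?\<beta> (cutoff R f) \<le> \<dots>" .
  qed
  moreover have "2 * (Q * (\<kappa> * C1)) > 0" using Q C1 \<kappa> by simp
  ultimately show ?thesis by blast
qed

section \<open>Comparison of the norms\<close>

text \<open>Each factor shifts the weight by two powers of \<open>1 + norm z\<close>, so the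
  induction hypothesis is used at a shifted \<alpha>.\<close>

lemma S_norm_euler_prod_ge:
  assumes p: "p > 0"
  shows "\<exists>C>0. \<forall>f :: complex ^ 'n \<Rightarrow> complex. slice_entire f \<longrightarrow>
    S_norm p (\<alpha> - weight_shift p (2 * real m)) f \<le> ennreal C * S_norm p \<alpha> (euler_prod m f)"
proof (induction m arbitrary: \<alpha>)
  case 0
  show ?case by (intro exI[of _ 1]) (simp add: weight_shift_def)
next
  case (Suc m)
  obtain C where C: "C > 0" "\<And>f :: complex ^ 'n \<Rightarrow> complex. slice_entire f \<Longrightarrow>
    S_norm p (\<alpha> - weight_shift p 2 - weight_shift p (2 * real m)) f
      \<le> ennreal C * S_norm p (\<alpha> - weight_shift p 2) (euler_prod m f)"
    using Suc.IH by blast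
  have c: "CARD('n) + m \<ge> 1"
    using zero_less_card_finite[where 'a='n] by linarith
  obtain C' where C': "C' > 0" "\<And>f :: complex ^ 'n \<Rightarrow> complex. slice_entire f \<Longrightarrow>
    S_norm p (\<alpha> - weight_shift p 2) f \<le> ennreal C' * S_norm p \<alpha> (euler (CARD('n) + m) f)"
    using S_norm_euler_ge[OF p c, of \<alpha>, where 'n='n] by blast
  have "S_norm p (\<alpha> - weight_shift p (2 * real (Suc m))) f \<le> ennreal (C * C') * S_norm p \<alpha> (euler_prod (Suc m) f)"
    if f: "slice_entire f" for f :: "complex ^ 'n \<Rightarrow> complex"
  proof -
    have w: "\<alpha> - weight_shift p (2 * real (Suc m)) = \<alpha> - weight_shift p 2 - weight_shift p (2 * real m)"
      by (simp add: weight_shift_def algebra_simps)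
    have "S_norm p (\<alpha> - weight_shift p (2 * real (Suc m))) f \<le> ennreal C * S_norm p (\<alpha> - weight_shift p 2) (euler_prod m f)"
      unfolding w by (rule C(2)[OF f])
    also have "\<dots> \<le> ennreal C * (ennreal C' * S_norm p \<alpha> (euler (CARD('n) + m) (euler_prod m f)))"
      by (intro mult_left_mono C'(2) slice_entire_euler_prod f) simp
    also have "\<dots> = ennreal (C * C') * S_norm p \<alpha> (euler_prod (Suc m) f)"
      using C(1) C'(1) by (simp add: ennreal_mult mult.assoc)
    finally show ?thesis .
  qed
  moreover have "C * C' > 0" using C C' by simp
  ultimately show ?case by blast
qed

text \<open>Cauchy's estimate with radius \<open>1 / (1 + norm z)\<close> costs one factor
  \<open>1 + norm z\<close>, which becomes a shift of the weight. The maximum of the modulus over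
  the closed ball is attained, so a value at one nearby point dominates.\<close>

lemma S_norm_partial_deriv_le:
  assumes p: "p > 0"
  shows "\<exists>C>0. \<forall>(f :: complex ^ 'n \<Rightarrow> complex) j. slice_entire f \<longrightarrow>
    S_norm p \<alpha> (partial_deriv j f) \<le> ennreal C * S_norm p (\<alpha> - weight_shift p 1) f"
proof -
  obtain C where C: "C > 0" "\<And>(f :: complex ^ 'n \<Rightarrow> complex) \<psi>. slice_entire f \<Longrightarrow>
    \<forall>z. \<exists>y. norm (\<psi> z) \<le> norm (f y) \<and> dist y z \<le> 1 / (1 + norm z) \<Longrightarrow>
    S_norm p (\<alpha> - weight_shift p 1) \<psi> \<le> ennreal C * S_norm p (\<alpha> - weight_shift p 1) f"
    using S_norm_nearby[OF p zero_le_one, of "\<alpha> - weight_shift p 1", where 'n='n] by blast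
  have "S_norm p \<alpha> (partial_deriv j f) \<le> ennreal C * S_norm p (\<alpha> - weight_shift p 1) f"
    if f: "slice_entire f" for f :: "complex ^ 'n \<Rightarrow> complex" and j
  proof -
    have pos: "1 + norm z > 0" for z :: "complex ^ 'n" using norm_ge_zero[of z] by linarith
    define \<psi> where "\<psi> z = of_real (1 / (1 + norm z)) * partial_deriv j f z" for z :: "complex ^ 'n"
    have near: "\<exists>y. norm (\<psi> z) \<le> norm (f y) \<and> dist y z \<le> 1 / (1 + norm z)" for z
    proof -
      define d where "d = 1 / (1 + norm z)"
      have d: "d > 0" using pos[of z] by (simp add: d_def)
      have "continuous_on (cball z d) (\<lambda>y. norm (f y))"
        by (intro continuous_intros continuous_on_subset[OF slice_entire_continuous[OF f]]) auto
      then obtain y where y: "y \<in> cball z d" "\<And>w. w \<in> cball z d \<Longrightarrow> norm (f w) \<le> norm (f y)"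
        using continuous_attains_sup[of "cball z d" "\<lambda>y. norm (f y)"] d by auto
      have "norm (partial_deriv j f z) \<le> norm (f y) / d"
        using y(2) by (intro partial_deriv_bound[OF f d]) (simp add: dist_commute)
      hence "d * norm (partial_deriv j f z) \<le> norm (f y)" using d by (simp add: field_simps)
      moreover have "norm (\<psi> z) = d * norm (partial_deriv j f z)"
        unfolding \<psi>_def norm_mult norm_of_real d_def using pos[of z] by simp
      ultimately show ?thesis using y(1) by (auto simp: d_def dist_commute)
    qed
    have "partial_deriv j f = (\<lambda>z. of_real ((1 + norm z) powr 1) * \<psi> z)"
    proof
      fix z :: "complex ^ 'n"
      have "complex_of_real ((1 + norm z) powr 1) * of_real (1 / (1 + norm z)) = 1"
        using pos[of z] unfolding of_real_mult[symmetric] by simp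
      thus "partial_deriv j f z = of_real ((1 + norm z) powr 1) * \<psi> z"
        unfolding \<psi>_def mult.assoc[symmetric] by simp
    qed
    hence "S_norm p \<alpha> (partial_deriv j f) = S_norm p (\<alpha> - weight_shift p 1) \<psi>"
      using S_norm_weight[of p \<alpha> 1 \<psi>] by simp
    also have "\<dots> \<le> ennreal C * S_norm p (\<alpha> - weight_shift p 1) f"
      by (rule C(2)[OF f]) (use near in blast)
    finally show ?thesis .
  qed
  with C(1) show ?thesis by blast
qed

lemma S_norm_multi_deriv_le:
  assumes p: "p > 0"
  shows "\<exists>C>0. \<forall>(f :: complex ^ 'n \<Rightarrow> complex) \<gamma>. slice_entire f \<longrightarrow> multi_order \<gamma> = k \<longrightarrow>
    S_norm p \<alpha> (multi_deriv \<gamma> f) \<le> ennreal C * S_norm p (\<alpha> - weight_shift p (real k)) f"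
proof (induction k arbitrary: \<alpha>)
  case 0
  show ?case
    by (intro exI[of _ 1]) (simp add: weight_shift_def multi_order_0_iff multi_deriv_0)
next
  case (Suc k)
  obtain C where C: "C > 0" "\<And>(f :: complex ^ 'n \<Rightarrow> complex) \<gamma>. slice_entire f \<Longrightarrow> multi_order \<gamma> = k \<Longrightarrow>
    S_norm p (\<alpha> - weight_shift p 1) (multi_deriv \<gamma> f)
      \<le> ennreal C * S_norm p (\<alpha> - weight_shift p 1 - weight_shift p (real k)) f"
    using Suc.IH by blast
  obtain C' where C': "C' > 0" "\<And>(f :: complex ^ 'n \<Rightarrow> complex) j. slice_entire f \<Longrightarrow>
    S_norm p \<alpha> (partial_deriv j f) \<le> ennreal C' * S_norm p (\<alpha> - weight_shift p 1) f"
    using S_norm_partial_deriv_le[OF p, of \<alpha>, where 'n='n] by blast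
  have "S_norm p \<alpha> (multi_deriv \<gamma> f) \<le> ennreal (C' * C) * S_norm p (\<alpha> - weight_shift p (real (Suc k))) f"
    if f: "slice_entire f" and \<gamma>: "multi_order \<gamma> = Suc k" for f :: "complex ^ 'n \<Rightarrow> complex" and \<gamma>
  proof -
    obtain j \<gamma>' where \<gamma>': "\<gamma> = \<gamma>'(j := Suc (\<gamma>' j))" "multi_order \<gamma>' = k"
      using multi_order_Suc_cases[OF \<gamma>] by blast
    have w: "\<alpha> - weight_shift p (real (Suc k)) = \<alpha> - weight_shift p 1 - weight_shift p (real k)"
      by (simp add: weight_shift_def algebra_simps)
    have "S_norm p \<alpha> (multi_deriv \<gamma> f) = S_norm p \<alpha> (partial_deriv j (multi_deriv \<gamma>' f))"
      unfolding \<gamma>'(1) partial_deriv_multi_deriv[OF f] ..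
    also have "\<dots> \<le> ennreal C' * S_norm p (\<alpha> - weight_shift p 1) (multi_deriv \<gamma>' f)"
      by (intro C'(2) slice_entire_multi_deriv f)
    also have "\<dots> \<le> ennreal C' * (ennreal C * S_norm p (\<alpha> - weight_shift p (real (Suc k))) f)"
      unfolding w by (intro mult_left_mono C(2) f \<gamma>'(2)) simp
    also have "\<dots> = ennreal (C' * C) * S_norm p (\<alpha> - weight_shift p (real (Suc k))) f"
      using C(1) C'(1) by (simp add: ennreal_mult mult.assoc)
    finally show ?thesis .
  qed
  moreover have "C' * C > 0" using C C' by simp
  ultimately show ?case by blast
qed

text \<open>Brings derivatives of order below \<open>m\<close>, which cost fewer powers of
  \<open>1 + norm z\<close>, to the weight required by order \<open>m\<close>.\<close>

lemma S_norm_weight_mono: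
  fixes f :: "complex ^ 'n \<Rightarrow> complex"
  assumes p: "p > 0" and f: "slice_entire f" and st: "s \<le> t"
  shows "S_norm p (\<alpha> - weight_shift p s) f \<le> S_norm p (\<alpha> - weight_shift p t) f"
proof -
  note [measurable] = borel_measurable_slice_entire[OF f]
  have "S_norm p \<alpha> (\<lambda>z. of_real ((1 + norm z) powr s) * f z)
      \<le> ennreal 1 * S_norm p \<alpha> (\<lambda>z. of_real ((1 + norm z) powr t) * f z)"
  proof (rule S_norm_mono[OF p])
    show "(\<lambda>z. complex_of_real ((1 + norm z) powr t) * f z) \<in> borel_measurable borel"
      by measurable
    fix z :: "complex ^ 'n"
    have "(1 + norm z) powr s \<le> (1 + norm z) powr t" using st by (intro powr_mono) auto
    thus "norm (complex_of_real ((1 + norm z) powr s) * f z) \<le> 1 * norm (complex_of_real ((1 + norm z) powr t) * f z)"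
      unfolding norm_mult norm_of_real by (simp add: mult_right_mono)
  qed simp
  thus ?thesis by (simp add: S_norm_weight)
qed

lemma continuous_on_R_op:
  assumes "slice_entire f"
  shows "continuous_on UNIV (R_op m f)"
proof -
  have "1 + norm z \<noteq> 0" for z :: "complex ^ 'a"
    using norm_ge_zero[of z] by linarith
  hence "complex_of_real ((1 + norm z) ^ m) \<noteq> 0" for z :: "complex ^ 'a"
    unfolding of_real_eq_0_iff by simp
  thus ?thesis
    unfolding R_op_def D_op_eq_euler_prod[OF assms]
    by (intro continuous_intros slice_entire_continuous slice_entire_euler_prod assms) auto
qed

lemma F_norm_eq_S_norm:
  assumes f: "slice_entire f"
  shows "F_norm p \<alpha> m f = S_norm p (\<alpha> - weight_shift p (- real m)) (euler_prod m f)"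
proof -
  have "R_op m f = (\<lambda>z. of_real ((1 + norm z) powr (- real m)) * euler_prod m f z)"
  proof
    fix z :: "complex ^ 'a"
    have "1 + norm z > 0" using norm_ge_zero[of z] by linarith
    hence "(1 + norm z) powr (- real m) = inverse ((1 + norm z) ^ m)"
      by (simp add: powr_minus powr_realpow)
    thus "R_op m f z = of_real ((1 + norm z) powr (- real m)) * euler_prod m f z"
      unfolding R_op_def D_op_eq_euler_prod[OF f] by (simp only: of_real_inverse divide_inverse mult.commute)
  qed
  thus ?thesis
    unfolding F_norm_def L_norm_eq_S_norm[OF continuous_on_R_op[OF f]] S_norm_weight[symmetric] by simp
qed

lemma L_norm_multi_deriv_eq:
  "slice_entire f \<Longrightarrow> L_norm p \<alpha> (multi_deriv \<gamma> f) = S_norm p \<alpha> (multi_deriv \<gamma> f)"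
  by (intro L_norm_eq_S_norm slice_entire_continuous slice_entire_multi_deriv)

lemma F_norm_le_sum_multi_deriv:
  assumes p: "p > 0"
  shows "\<exists>C>0. \<forall>f :: complex ^ 'n \<Rightarrow> complex. slice_entire f \<longrightarrow>
    F_norm p \<alpha> m f \<le> ennreal C * (\<Sum>\<gamma>\<in>{\<gamma>. multi_order \<gamma> \<le> m}. L_norm p \<alpha> (multi_deriv \<gamma> f))"
proof -
  let ?I = "{\<gamma> :: 'n \<Rightarrow> nat. multi_order \<gamma> \<le> m}"
  obtain C where C: "C \<ge> 0" "\<And>(f :: complex ^ 'n \<Rightarrow> complex) z. slice_entire f \<Longrightarrow>
     norm (multi_deriv (\<lambda>_. 0) (euler_prod m f) z) \<le> C * (1 + norm z) ^ m *
       (\<Sum>\<gamma>\<in>{\<gamma>. multi_order \<gamma> \<le> multi_order (\<lambda>_ :: 'n. 0) + m}. norm (multi_deriv \<gamma> f z))"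
    using multi_deriv_euler_prod_bound[of "\<lambda>_ :: 'n. 0" m] by blast
  have "(\<lambda>_. 0) \<in> ?I" by (simp add: multi_order_def)
  hence ne: "?I \<noteq> {}" by blast
  have "F_norm p \<alpha> m f \<le> ennreal ((C + 1) * quasi_const p (card ?I)) * (\<Sum>\<gamma>\<in>?I. L_norm p \<alpha> (multi_deriv \<gamma> f))"
    if f: "slice_entire f" for f :: "complex ^ 'n \<Rightarrow> complex"
  proof -
    have "norm (R_op m f z) \<le> (C + 1) * (\<Sum>\<gamma>\<in>?I. norm (multi_deriv \<gamma> f z))" for z
    proof -
      have pos: "(1 + norm z) ^ m > 0" using norm_ge_zero[of z] by (intro zero_less_power) linarith
      let ?S = "\<Sum>\<gamma>\<in>?I. norm (multi_deriv \<gamma> f z)"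
      have "norm (euler_prod m f z) \<le> C * (1 + norm z) ^ m * ?S"
        using C(2)[OF f, of z] by (simp add: multi_deriv_0 multi_order_def)
      \<comment> \<open>The pointwise bound gives only \<open>C \<ge> 0\<close>;
        \<open>C + 1\<close> is positive, as the sum estimate for \<open>S_norm\<close>
        demands.\<close>
      also have "\<dots> \<le> (C + 1) * ?S * (1 + norm z) ^ m"
        using pos by (simp add: algebra_simps sum_nonneg)
      finally have "norm (euler_prod m f z) / (1 + norm z) ^ m \<le> (C + 1) * ?S"
        using pos by (simp add: pos_divide_le_eq)
      moreover have "norm (R_op m f z) = norm (euler_prod m f z) / (1 + norm z) ^ m"
        unfolding R_op_def D_op_eq_euler_prod[OF f] norm_divide norm_of_real using pos by simp
      ultimately show ?thesis by simp
    qed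
    hence "S_norm p \<alpha> (R_op m f) \<le> ennreal ((C + 1) * quasi_const p (card ?I)) * (\<Sum>\<gamma>\<in>?I. S_norm p \<alpha> (multi_deriv \<gamma> f))"
      using C(1) by (intro S_norm_sum_le p ne finite_multi_order_le borel_measurable_slice_entire slice_entire_multi_deriv f) auto
    thus ?thesis
      unfolding F_norm_def L_norm_eq_S_norm[OF continuous_on_R_op[OF f]] L_norm_multi_deriv_eq[OF f] .
  qed
  moreover have "card ?I > 0" using ne finite_multi_order_le[of m] by (simp add: card_gt_0_iff)
  hence "(C + 1) * quasi_const p (card ?I) > 0" using C(1) by (simp add: quasi_const_pos)
  ultimately show ?thesis by blast
qed

text \<open>The powers of \<open>1 + norm z\<close> balance exactly: \<open>m\<close> Euler
  operators gain \<open>2 * m\<close>, the division in \<open>R_op\<close> takes back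
  \<open>m\<close>, and the remaining \<open>m\<close> pay for derivatives up to order
  \<open>m\<close>.\<close>

lemma sum_multi_deriv_le_F_norm:
  assumes p: "p > 0"
  shows "\<exists>C>0. \<forall>f :: complex ^ 'n \<Rightarrow> complex. slice_entire f \<longrightarrow>
    (\<Sum>\<gamma>\<in>{\<gamma>. multi_order \<gamma> \<le> m}. L_norm p \<alpha> (multi_deriv \<gamma> f)) \<le> ennreal C * F_norm p \<alpha> m f"
proof -
  let ?I = "{\<gamma> :: 'n \<Rightarrow> nat. multi_order \<gamma> \<le> m}"
  let ?\<beta> = "\<alpha> - weight_shift p (- real m)"
  obtain A where A: "A > 0" "\<And>f :: complex ^ 'n \<Rightarrow> complex. slice_entire f \<Longrightarrow>
      S_norm p (?\<beta> - weight_shift p (2 * real m)) f \<le> ennreal A * S_norm p ?\<beta> (euler_prod m f)"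
    using S_norm_euler_prod_ge[OF p, of ?\<beta> m, where 'n='n] by blast
  have "\<forall>k. \<exists>C>0. \<forall>(f :: complex ^ 'n \<Rightarrow> complex) \<gamma>. slice_entire f \<longrightarrow> multi_order \<gamma> = k \<longrightarrow>
      S_norm p \<alpha> (multi_deriv \<gamma> f) \<le> ennreal C * S_norm p (\<alpha> - weight_shift p (real k)) f"
    using S_norm_multi_deriv_le[OF p] by blast
  then obtain B where B: "\<And>k. B k > 0" "\<And>(f :: complex ^ 'n \<Rightarrow> complex) \<gamma>. slice_entire f \<Longrightarrow>
      S_norm p \<alpha> (multi_deriv \<gamma> f)
        \<le> ennreal (B (multi_order \<gamma>)) * S_norm p (\<alpha> - weight_shift p (real (multi_order \<gamma>))) f"
    by metis
  have w: "?\<beta> - weight_shift p (2 * real m) = \<alpha> - weight_shift p (real m)"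
    by (simp add: weight_shift_def algebra_simps)
  let ?C = "(\<Sum>\<gamma>\<in>?I. B (multi_order \<gamma>)) * A"
  have "(\<Sum>\<gamma>\<in>?I. L_norm p \<alpha> (multi_deriv \<gamma> f)) \<le> ennreal ?C * F_norm p \<alpha> m f"
    if f: "slice_entire f" for f :: "complex ^ 'n \<Rightarrow> complex"
  proof -
    have "L_norm p \<alpha> (multi_deriv \<gamma> f) \<le> ennreal (B (multi_order \<gamma>)) * (ennreal A * F_norm p \<alpha> m f)"
      if "\<gamma> \<in> ?I" for \<gamma>
    proof -
      have "S_norm p (\<alpha> - weight_shift p (real (multi_order \<gamma>))) f \<le> S_norm p (\<alpha> - weight_shift p (real m)) f"
        using that by (intro S_norm_weight_mono[OF p f]) simp
      also have "\<dots> \<le> ennreal A * F_norm p \<alpha> m f"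
        using A(2)[OF f] unfolding w F_norm_eq_S_norm[OF f] .
      finally show ?thesis
        using B(2)[OF f, of \<gamma>] unfolding L_norm_multi_deriv_eq[OF f]
        by (meson mult_left_mono order_trans zero_le)
    qed
    hence "(\<Sum>\<gamma>\<in>?I. L_norm p \<alpha> (multi_deriv \<gamma> f))
        \<le> (\<Sum>\<gamma>\<in>?I. ennreal (B (multi_order \<gamma>)) * (ennreal A * F_norm p \<alpha> m f))"
      by (rule sum_mono)
    also have "\<dots> = ennreal (\<Sum>\<gamma>\<in>?I. B (multi_order \<gamma>)) * (ennreal A * F_norm p \<alpha> m f)"
    proof -
      have "(\<Sum>\<gamma>\<in>?I. ennreal (B (multi_order \<gamma>))) = ennreal (\<Sum>\<gamma>\<in>?I. B (multi_order \<gamma>))"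
        by (rule sum_ennreal) (simp add: B(1) less_imp_le)
      thus ?thesis by (simp only: sum_distrib_right[symmetric])
    qed
    also have "\<dots> = ennreal ?C * F_norm p \<alpha> m f"
    proof -
      have "ennreal ?C = ennreal (\<Sum>\<gamma>\<in>?I. B (multi_order \<gamma>)) * ennreal A"
        using A(1) B(1) by (intro ennreal_mult sum_nonneg) (auto simp: less_imp_le)
      thus ?thesis by (simp only: mult.assoc)
    qed
    finally show ?thesis .
  qed
  moreover have "?C > 0"
  proof (intro mult_pos_pos sum_pos A(1) B(1) finite_multi_order_le)
    have "(\<lambda>_. 0) \<in> ?I" by (simp add: multi_order_def)
    thus "?I \<noteq> {}" by blast
  qed
  ultimately show ?thesis by blast
qed

theorem corollary4p4:
  fixes p :: ennreal and m :: nat and \<alpha> :: real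
  assumes "0 < p" and "0 < m"
  shows "\<exists>C::real. 0 < C \<and>
    (\<forall>f :: complex ^ 'n \<Rightarrow> complex. entire f \<longrightarrow>
       ennreal (inverse C) * F_norm p \<alpha> m f
         \<le> (\<Sum>\<gamma>\<in>{\<gamma> :: 'n \<Rightarrow> nat. multi_order \<gamma> \<le> m}. L_norm p \<alpha> (multi_deriv \<gamma> f)) \<and>
       (\<Sum>\<gamma>\<in>{\<gamma> :: 'n \<Rightarrow> nat. multi_order \<gamma> \<le> m}. L_norm p \<alpha> (multi_deriv \<gamma> f))
         \<le> ennreal C * F_norm p \<alpha> m f)"
proof -
  let ?S = "\<lambda>f. \<Sum>\<gamma>\<in>{\<gamma> :: 'n \<Rightarrow> nat. multi_order \<gamma> \<le> m}. L_norm p \<alpha> (multi_deriv \<gamma> f)"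
  obtain A where A: "A > 0" "\<And>f :: complex ^ 'n \<Rightarrow> complex. slice_entire f \<Longrightarrow>
      F_norm p \<alpha> m f \<le> ennreal A * ?S f"
    using F_norm_le_sum_multi_deriv[OF assms(1), where \<alpha>=\<alpha> and m=m and 'n='n] by blast
  obtain B where B: "B > 0" "\<And>f :: complex ^ 'n \<Rightarrow> complex. slice_entire f \<Longrightarrow>
      ?S f \<le> ennreal B * F_norm p \<alpha> m f"
    using sum_multi_deriv_le_F_norm[OF assms(1), where \<alpha>=\<alpha> and m=m and 'n='n] by blast
  define C where "C = max A B"
  have C: "C > 0" "A \<le> C" "B \<le> C" using A(1) by (auto simp: C_def)
  show ?thesis
  proof (intro exI[of _ C] conjI allI impI C(1))
    fix f :: "complex ^ 'n \<Rightarrow> complex" assume "entire f"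
    hence f: "slice_entire f" by (rule slice_entire_if_entire)
    have "ennreal (inverse C) * F_norm p \<alpha> m f \<le> ennreal (inverse C) * (ennreal C * ?S f)"
      using A(2)[OF f] C(2) by (intro mult_left_mono order_trans[OF A(2)[OF f]] mult_right_mono ennreal_leI) auto
    also have "\<dots> = ennreal (inverse C * C) * ?S f"
      using C(1) by (subst ennreal_mult) (auto simp: mult.assoc)
    also have "\<dots> = ?S f" using C(1) by simp
    finally show "ennreal (inverse C) * F_norm p \<alpha> m f \<le> ?S f" .
    show "?S f \<le> ennreal C * F_norm p \<alpha> m f"
      by (rule order_trans[OF B(2)[OF f]]) (intro mult_right_mono ennreal_leI C(3), simp)
  qed
qed

end
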